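(* Let $(M,\nabla)$ be an affine surface, let $T\neq0$ be a tensor field of type $(1,1)$ on $M$, let $\Phi$ be a symmetric $2$-tensor on $M$, and let $\mathcal{N}=(T^*M,g_{T,\nabla,\Phi})$ be the associated modified Riemannian extension, with curvature tensor $R$, Ricci tensor $\rho$ and scalar curvature $\tau$. The following assertions are equivalent: (1) $\mathcal{N}$ is VSI. (2) $\|R\|^2=\|\rho\|^2=0$. (3) $\|\rho\|^2=\tau=0$. (4) $T$ is nilpotent.
   Context: An affine surface $(M,\nabla)$ is a smooth $2$-dimensional manifold $M$ with a torsion-free connection $\nabla$ on $TM$; in local coordinates $(x^1,x^2)$, $\nabla_{\partial_{x^i}}\partial_{x^j}=\Gamma_{ij}{}^k\partial_{x^k}$ (repeated indices are summed). Let $(y_1,y_2)$ be the dual fiber coordinates on $T^*M$, where a $1$-form is written $\omega=y_1dx^1+y_2dx^2$. For $T=T^r{}_i\,\partial_{x^r}\otimes dx^i$ a type $(1,1)$ tensor field (an endomorphism of $TM$) and $\Phi=\Phi_{ij}dx^i\circ dx^j$ a symmetric $2$-tensor on $M$, the modified Riemannian extension is the neutral signature $(2,2)$ metric on $T^*M$ $$g_{T,\nabla,\Phi}=2\,dx^i\circ dy_i+\left\{\tfrac12 y_ry_s(T^r{}_iT^s{}_j+T^r{}_jT^s{}_i)-2y_k\Gamma_{ij}{}^k+\Phi_{ij}\right\}dx^i\circ dx^j,$$ where $\circ$ is the symmetric product (so $g(\partial_{x^i},\partial_{y_j})=\delta_{ij}$, $g(\partial_{y_i},\partial_{y_j})=0$,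 and $g(\partial_{x^i},\partial_{x^j})$ is the expression in braces); it is independent of the choice of local coordinates. A pseudo-Riemannian manifold is VSI (vanishing scalar invariants) if all its scalar Weyl invariants vanish identically, i.e. all scalars formed by complete contractions (using the metric) of indices in the Riemann curvature tensor $R_{ijk\ell}$ and its iterated covariant derivatives. Here $\|R\|^2=R_{ijk\ell}R^{ijk\ell}$ and $\|\rho\|^2=\rho_{ij}\rho^{ij}$ are the (indefinite) squared norms taken with respect to $g_{T,\nabla,\Phi}$. $T$ nilpotent means $T^2=0$ at every point of $M$. *)

theory Defs
  imports "HOL-Analysis.Analysis"
begin

subsection \<open>Partial derivatives and smoothness on open subsets of Euclidean space\<close>

definition partial :: "'n \<Rightarrow> (real^'n \<Rightarrow> real) \<Rightarrow> real^'n \<Rightarrow> real" where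
  "partial i f x = frechet_derivative f (at x) (axis i 1)"

(* C^\<infinity>: every iterated partial derivative exists and is Frechet differentiable, hence continuous. *)
definition smooth_on :: "(real^'n) set \<Rightarrow> (real^'n \<Rightarrow> real) \<Rightarrow> bool" where
  "smooth_on S f \<longleftrightarrow> open S \<and> (\<forall>is. \<forall>x\<in>S. fold partial is f differentiable (at x))"

subsection \<open>Smooth manifolds\<close>

(* A manifold modelled on real^'n is a set of points with an indexed atlas; its topology is the
   one determined by the charts. Only the values of chart_map M c on chart_dom M c matter. *)
record ('a, 'c, 'n) manifold =
  points :: "'a set"
  charts :: "'c set"
  chart_dom :: "'c \<Rightarrow> 'a set"
  chart_map :: "'c \<Rightarrow> 'a \<Rightarrow> real^'n"

definition chart_range :: "('a, 'c, 'n::finite) manifold \<Rightarrow> 'c \<Rightarrow> (real^'n) set" where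
  "chart_range M c = chart_map M c ` chart_dom M c"

definition chart_overlap :: "('a, 'c, 'n::finite) manifold \<Rightarrow> 'c \<Rightarrow> 'c \<Rightarrow> (real^'n) set" where
  "chart_overlap M c c' = chart_map M c ` (chart_dom M c \<inter> chart_dom M c')"

(* the change of coordinates from chart c to chart c' *)
definition transition :: "('a, 'c, 'n::finite) manifold \<Rightarrow> 'c \<Rightarrow> 'c \<Rightarrow> real^'n \<Rightarrow> real^'n" where
  "transition M c c' = chart_map M c' \<circ> inv_into (chart_dom M c) (chart_map M c)"

definition manifold_topology :: "('a, 'c, 'n::finite) manifold \<Rightarrow> 'a topology" where
  "manifold_topology M =
     topology_generated_by
       {{p \<in> chart_dom M c. chart_map M c p \<in> V} | c V. c \<in> charts M \<and> open V}"

(* For c = c' the third clause says that the range of a chart is open. *)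
definition smooth_manifold :: "('a, 'c, 'n::finite) manifold \<Rightarrow> bool" where
  "smooth_manifold M \<longleftrightarrow>
     points M = (\<Union>c\<in>charts M. chart_dom M c) \<and>
     (\<forall>c\<in>charts M. inj_on (chart_map M c) (chart_dom M c)) \<and>
     (\<forall>c\<in>charts M. \<forall>c'\<in>charts M. open (chart_overlap M c c')) \<and>
     (\<forall>c\<in>charts M. \<forall>c'\<in>charts M. \<forall>a.
        smooth_on (chart_overlap M c c') (\<lambda>x. transition M c c' x $ a)) \<and>
     Hausdorff_space (manifold_topology M) \<and>
     second_countable (manifold_topology M)"

subsection \<open>Tensor fields and connections in local coordinates\<close>

text \<open>
  Tensor fields and connections are families of components, one for each chart, which are smooth
  on the range of the chart and obey the usual transformation law on overlaps. The components in
  a chart are functions of the coordinates; their values outside the chart range are irrelevant.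
  Below, \<open>x\<close> are the coordinates of a point in chart \<open>c\<close>, \<open>x'\<close> those in chart \<open>c'\<close>,
  and the Jacobian \<open>J\<close> has entries \<open>J $ a $ i\<close>, the derivative of the \<open>a\<close>-th
  coordinate of \<open>x'\<close> with respect to the \<open>i\<close>-th coordinate of \<open>x\<close>.
\<close>

type_synonym ('c, 'n) matrix_field = "'c \<Rightarrow> real^'n \<Rightarrow> real^'n^'n"

(* christoffel_field: G c x i j k stands for the symbol with lower indices i, j and upper index k *)
type_synonym ('c, 'n) christoffel_field = "'c \<Rightarrow> real^'n \<Rightarrow> 'n \<Rightarrow> 'n \<Rightarrow> 'n \<Rightarrow> real"

(* T c x $ r $ i is the component with upper index r and lower index i, so that T c x acts on
   coordinate vectors by *v and composition of endomorphisms is ** *)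
definition tensor_field_1_1 ::
    "('a, 'c, 'n::finite) manifold \<Rightarrow> ('c, 'n) matrix_field \<Rightarrow> bool" where
  "tensor_field_1_1 M T \<longleftrightarrow>
     (\<forall>c\<in>charts M. \<forall>r i. smooth_on (chart_range M c) (\<lambda>x. T c x $ r $ i)) \<and>
     (\<forall>c\<in>charts M. \<forall>c'\<in>charts M. \<forall>x\<in>chart_overlap M c c'.
        let J = jacobian (transition M c c') (at x) in
        T c' (transition M c c' x) ** J = J ** T c x)"

definition symmetric_2_tensor_field ::
    "('a, 'c, 'n::finite) manifold \<Rightarrow> ('c, 'n) matrix_field \<Rightarrow> bool" where
  "symmetric_2_tensor_field M \<Phi> \<longleftrightarrow>
     (\<forall>c\<in>charts M. \<forall>i j. smooth_on (chart_range M c) (\<lambda>x. \<Phi> c x $ i $ j)) \<and>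
     (\<forall>c\<in>charts M. \<forall>x\<in>chart_range M c. \<forall>i j. \<Phi> c x $ i $ j = \<Phi> c x $ j $ i) \<and>
     (\<forall>c\<in>charts M. \<forall>c'\<in>charts M. \<forall>x\<in>chart_overlap M c c'.
        let J = jacobian (transition M c c') (at x) in
        \<Phi> c x = transpose J ** \<Phi> c' (transition M c c' x) ** J)"

definition connection ::
    "('a, 'c, 'n::finite) manifold \<Rightarrow> ('c, 'n) christoffel_field \<Rightarrow> bool" where
  "connection M \<Gamma> \<longleftrightarrow>
     (\<forall>c\<in>charts M. \<forall>i j k. smooth_on (chart_range M c) (\<lambda>x. \<Gamma> c x i j k)) \<and>
     (\<forall>c\<in>charts M. \<forall>c'\<in>charts M. \<forall>x\<in>chart_overlap M c c'. \<forall>i j a.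
        let J = jacobian (transition M c c') (at x); x' = transition M c c' x in
        (\<Sum>k\<in>UNIV. J $ a $ k * \<Gamma> c x i j k) =
          partial i (partial j (\<lambda>u. transition M c c' u $ a)) x +
          (\<Sum>b\<in>UNIV. \<Sum>d\<in>UNIV. \<Gamma> c' x' b d a * J $ b $ i * J $ d $ j))"

definition torsion_free ::
    "('a, 'c, 'n::finite) manifold \<Rightarrow> ('c, 'n) christoffel_field \<Rightarrow> bool" where
  "torsion_free M \<Gamma> \<longleftrightarrow>
     (\<forall>c\<in>charts M. \<forall>x\<in>chart_range M c. \<forall>i j k. \<Gamma> c x i j k = \<Gamma> c x j i k)"

definition affine_surface ::
    "('a, 'c, 2) manifold \<Rightarrow> ('c, 2) christoffel_field \<Rightarrow> bool" where
  "affine_surface M \<Gamma> \<longleftrightarrow> smooth_manifold M \<and> connection M \<Gamma> \<and> torsion_free M \<Gamma>"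

definition nilpotent_1_1 ::
    "('a, 'c, 'n::finite) manifold \<Rightarrow> ('c, 'n) matrix_field \<Rightarrow> bool" where
  "nilpotent_1_1 M T \<longleftrightarrow> (\<forall>c\<in>charts M. \<forall>x\<in>chart_range M c. T c x ** T c x = 0)"

(* the tensor field is the zero tensor field, i.e. vanishes at every point *)
definition zero_1_1 ::
    "('a, 'c, 'n::finite) manifold \<Rightarrow> ('c, 'n) matrix_field \<Rightarrow> bool" where
  "zero_1_1 M T \<longleftrightarrow> (\<forall>c\<in>charts M. \<forall>x\<in>chart_range M c. T c x = 0)"

subsection \<open>The cotangent bundle and the modified Riemannian extension\<close>

(* A covector at p is the family of its coefficient vectors in the charts around p; it is set to 0
   at all other indices, so that distinct families are distinct covectors. *)
definition cotangent_space ::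
    "('a, 'c, 'n::finite) manifold \<Rightarrow> 'a \<Rightarrow> ('c \<Rightarrow> real^'n) set" where
  "cotangent_space M p =
     {\<omega>. (\<forall>c\<in>charts M. \<forall>c'\<in>charts M. p \<in> chart_dom M c \<longrightarrow> p \<in> chart_dom M c' \<longrightarrow>
            \<omega> c = transpose (jacobian (transition M c c') (at (chart_map M c p))) *v \<omega> c') \<and>
          (\<forall>c. \<not> (c \<in> charts M \<and> p \<in> chart_dom M c) \<longrightarrow> \<omega> c = 0)}"

(* The coordinate x^i of the base has index Inl i, the fibre coordinate y_i has index Inr i. *)
definition cotangent_bundle ::
    "('a, 'c, 'n::finite) manifold \<Rightarrow> ('a \<times> ('c \<Rightarrow> real^'n), 'c, 'n + 'n) manifold" where
  "cotangent_bundle M =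
     \<lparr>points = (SIGMA p:points M. cotangent_space M p),
      charts = charts M,
      chart_dom = (\<lambda>c. SIGMA p:chart_dom M c. cotangent_space M p),
      chart_map = (\<lambda>c (p, \<omega>). \<chi> a. case a of Inl i \<Rightarrow> chart_map M c p $ i | Inr i \<Rightarrow> \<omega> c $ i)\<rparr>"

definition base_coords :: "real^('n + 'n) \<Rightarrow> real^'n" where
  "base_coords z = (\<chi> i. z $ Inl i)"

definition fibre_coords :: "real^('n + 'n) \<Rightarrow> real^'n" where
  "fibre_coords z = (\<chi> i. z $ Inr i)"

definition modified_riemannian_extension ::
    "('c, 'n::finite) matrix_field \<Rightarrow> ('c, 'n) christoffel_field \<Rightarrow> ('c, 'n) matrix_field
       \<Rightarrow> ('c, 'n + 'n) matrix_field" where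
  "modified_riemannian_extension T \<Gamma> \<Phi> c z =
     (let x = base_coords z; y = fibre_coords z in
      \<chi> a b. case (a, b) of
        (Inl i, Inl j) \<Rightarrow>
          (1/2) * (\<Sum>r\<in>UNIV. \<Sum>s\<in>UNIV. y $ r * y $ s *
             (T c x $ r $ i * T c x $ s $ j + T c x $ r $ j * T c x $ s $ i))
          - 2 * (\<Sum>k\<in>UNIV. y $ k * \<Gamma> c x i j k) + \<Phi> c x $ i $ j
      | (Inl i, Inr j) \<Rightarrow> if i = j then 1 else 0
      | (Inr i, Inl j) \<Rightarrow> if i = j then 1 else 0
      | (Inr i, Inr j) \<Rightarrow> 0)"

subsection \<open>Curvature of a pseudo-Riemannian metric in local coordinates\<close>

text \<open>
  In this section \<open>g\<close> is the matrix of metric components in one fixed chart.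
\<close>

definition metric_inv :: "(real^'n \<Rightarrow> real^'n^'n) \<Rightarrow> real^'n \<Rightarrow> 'n \<Rightarrow> 'n \<Rightarrow> real" where
  "metric_inv g x i j = matrix_inv (g x) $ i $ j"

(* Christoffel symbols of the Levi-Civita connection, with lower indices i, j and upper index k *)
definition levi_civita ::
    "(real^'n \<Rightarrow> real^'n^'n) \<Rightarrow> real^'n \<Rightarrow> 'n \<Rightarrow> 'n \<Rightarrow> 'n \<Rightarrow> real" where
  "levi_civita g x i j k =
     (1/2) * (\<Sum>l\<in>UNIV. metric_inv g x k l *
       (partial i (\<lambda>u. g u $ j $ l) x + partial j (\<lambda>u. g u $ i $ l) x
          - partial l (\<lambda>u. g u $ i $ j) x))"

(* the l-th component of R(d_i, d_j) d_k, where R(X,Y) = [nabla_X, nabla_Y] - nabla_[X,Y] *)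
definition curvature_op ::
    "(real^'n \<Rightarrow> real^'n^'n) \<Rightarrow> real^'n \<Rightarrow> 'n \<Rightarrow> 'n \<Rightarrow> 'n \<Rightarrow> 'n \<Rightarrow> real" where
  "curvature_op g x i j k l =
     partial i (\<lambda>u. levi_civita g u j k l) x - partial j (\<lambda>u. levi_civita g u i k l) x
     + (\<Sum>m\<in>UNIV. levi_civita g x i m l * levi_civita g x j k m
                   - levi_civita g x j m l * levi_civita g x i k m)"

definition riemann ::
    "(real^'n \<Rightarrow> real^'n^'n) \<Rightarrow> real^'n \<Rightarrow> 'n \<Rightarrow> 'n \<Rightarrow> 'n \<Rightarrow> 'n \<Rightarrow> real" where
  "riemann g x i j k l = (\<Sum>m\<in>UNIV. g x $ l $ m * curvature_op g x i j k m)"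

(* rho(Y, Z) is the trace of X |-> R(X, Y) Z *)
definition ricci :: "(real^'n \<Rightarrow> real^'n^'n) \<Rightarrow> real^'n \<Rightarrow> 'n \<Rightarrow> 'n \<Rightarrow> real" where
  "ricci g x j k = (\<Sum>i\<in>UNIV. curvature_op g x i j k i)"

definition scalar_curvature :: "(real^'n \<Rightarrow> real^'n^'n) \<Rightarrow> real^'n \<Rightarrow> real" where
  "scalar_curvature g x = (\<Sum>i\<in>UNIV. \<Sum>j\<in>UNIV. metric_inv g x i j * ricci g x i j)"

definition riemann_norm_sq :: "(real^'n \<Rightarrow> real^'n^'n) \<Rightarrow> real^'n \<Rightarrow> real" where
  "riemann_norm_sq g x =
     (\<Sum>i\<in>UNIV. \<Sum>j\<in>UNIV. \<Sum>k\<in>UNIV. \<Sum>l\<in>UNIV. riemann g x i j k l *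
       (\<Sum>a\<in>UNIV. \<Sum>b\<in>UNIV. \<Sum>c\<in>UNIV. \<Sum>d\<in>UNIV.
          metric_inv g x i a * metric_inv g x j b * metric_inv g x k c * metric_inv g x l d
            * riemann g x a b c d))"

definition ricci_norm_sq :: "(real^'n \<Rightarrow> real^'n^'n) \<Rightarrow> real^'n \<Rightarrow> real" where
  "ricci_norm_sq g x =
     (\<Sum>i\<in>UNIV. \<Sum>j\<in>UNIV. ricci g x i j *
       (\<Sum>a\<in>UNIV. \<Sum>b\<in>UNIV. metric_inv g x i a * metric_inv g x j b * ricci g x a b))"

subsection \<open>Scalar Weyl invariants\<close>

text \<open>
  A covariant tensor of rank \<open>r\<close> is represented by its components, indexed by lists of length
  \<open>r\<close>; values at lists of other lengths are irrelevant. The direction of differentiation is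
  the first index of a covariant derivative.
\<close>

fun cov_deriv ::
    "(real^'n \<Rightarrow> real^'n^'n) \<Rightarrow> (real^'n \<Rightarrow> 'n list \<Rightarrow> real) \<Rightarrow> real^'n \<Rightarrow> 'n list \<Rightarrow> real" where
  "cov_deriv g A x [] = 0"
| "cov_deriv g A x (k # is) =
     partial k (\<lambda>u. A u is) x
     - (\<Sum>s<length is. \<Sum>m\<in>UNIV. levi_civita g x k (is ! s) m * A x (is[s := m]))"

definition riemann_tensor :: "(real^'n \<Rightarrow> real^'n^'n) \<Rightarrow> real^'n \<Rightarrow> 'n list \<Rightarrow> real" where
  "riemann_tensor g x is = riemann g x (is ! 0) (is ! 1) (is ! 2) (is ! 3)"

(* the k-th iterated covariant derivative of the curvature tensor, of rank k + 4 *)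
definition nabla_riemann :: "(real^'n \<Rightarrow> real^'n^'n) \<Rightarrow> nat \<Rightarrow> real^'n \<Rightarrow> 'n list \<Rightarrow> real" where
  "nabla_riemann g k = (cov_deriv g ^^ k) (riemann_tensor g)"

(* the tensor product of the iterated covariant derivatives of orders ks *)
fun curvature_monomial ::
    "(real^'n \<Rightarrow> real^'n^'n) \<Rightarrow> nat list \<Rightarrow> real^'n \<Rightarrow> 'n list \<Rightarrow> real" where
  "curvature_monomial g [] x is = 1"
| "curvature_monomial g (k # ks) x is =
     nabla_riemann g k x (take (k + 4) is) * curvature_monomial g ks x (drop (k + 4) is)"

definition monomial_rank :: "nat list \<Rightarrow> nat" where
  "monomial_rank ks = (\<Sum>k\<leftarrow>ks. k + 4)"

(* The complete contraction of a covariant tensor A of rank N (even) which pairs, by means of the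
   inverse metric, the index positions \<sigma> (2 j) and \<sigma> (2 j + 1) for all j < N div 2. Every perfect
   matching of the positions arises from some permutation \<sigma> of {..<N}. *)
definition complete_contraction ::
    "(real^'n \<Rightarrow> real^'n^'n) \<Rightarrow> nat \<Rightarrow> (nat \<Rightarrow> nat) \<Rightarrow> (real^'n \<Rightarrow> 'n list \<Rightarrow> real) \<Rightarrow> real^'n \<Rightarrow> real"
  where
  "complete_contraction g N \<sigma> A x =
     (\<Sum>is\<in>{is. length is = N}.
        (\<Prod>j<N div 2. metric_inv g x (is ! \<sigma> (2 * j)) (is ! \<sigma> (2 * j + 1))) * A x is)"

(* ks = [] is excluded: it would give the constant 1, which does not involve the curvature *)
definition scalar_weyl_invariants :: "(real^'n \<Rightarrow> real^'n^'n) \<Rightarrow> (real^'n \<Rightarrow> real) set" where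
  "scalar_weyl_invariants g =
     {complete_contraction g (monomial_rank ks) \<sigma> (curvature_monomial g ks) | ks \<sigma>.
        ks \<noteq> [] \<and> even (monomial_rank ks) \<and> \<sigma> permutes {..<monomial_rank ks}}"

(* F c is a scalar function written in the coordinates of chart c *)
definition vanishes_identically ::
    "('a, 'c, 'n::finite) manifold \<Rightarrow> ('c \<Rightarrow> real^'n \<Rightarrow> real) \<Rightarrow> bool" where
  "vanishes_identically N F \<longleftrightarrow> (\<forall>c\<in>charts N. \<forall>z\<in>chart_range N c. F c z = 0)"

definition VSI :: "('a, 'c, 'n::finite) manifold \<Rightarrow> ('c, 'n) matrix_field \<Rightarrow> bool" where
  "VSI N g \<longleftrightarrow>
     (\<forall>c\<in>charts N. \<forall>W\<in>scalar_weyl_invariants (g c). \<forall>z\<in>chart_range N c. W z = 0)"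

end

theory Submission
  imports Defs
begin

text \<open>
  Give a covariant index in a base direction the weight \<open>1\<close> and one in a fibre direction the weight
  \<open>-1\<close>. Each component of the metric \<open>g\<close> is a polynomial in the fibre coordinates of degree at
  most the weight of its indices. This bound is inherited by the Christoffel symbols, the curvature
  and all its covariant derivatives: differentiation along the fibre lowers both the degree and the
  weight, differentiation along the base raises the weight only. Consequently the terms of top
  degree over a point \<open>x0\<close> only depend on the value of \<open>T\<close> at \<open>x0\<close>, and a scalar invariant, which
  has weight \<open>0\<close>, takes over \<open>x0\<close> the same values as for the frozen metric in which \<open>T\<close> is replaced
  by the constant matrix \<open>T x0\<close> and \<open>\<Gamma>\<close> and \<open>\<Phi>\<close> by \<open>0\<close>.

  If the constant matrix is nilpotent, say \<open>u \<otimes> v\<close> with \<open>u \<bullet> v = 0\<close>, then the frozen curvature is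
  \<open>\<omega> \<otimes> \<omega>\<close> for a parallel two-form \<open>\<omega>\<close> which is the wedge product of two null and mutually orthogonal
  one-forms, so all contractions vanish. For arbitrary constant matrices the invariants of the
  statement are computed on the zero section, where they are polynomials in trace and determinant.
\<close>

subsection \<open>Partial derivatives\<close>

lemma smooth_onD:
  assumes "smooth_on S f"
  shows "open S" and "\<And>x. x \<in> S \<Longrightarrow> f differentiable (at x)" and "smooth_on S (partial i f)"
proof -
  show "open S"
    using assms by (simp add: smooth_on_def)
  show "f differentiable (at x)" if "x \<in> S" for x
  proof -
    have "fold partial [] f differentiable (at x)"
      using assms that unfolding smooth_on_def by blast
    then show ?thesis by simp
  qed
  have "fold partial is (partial i f) differentiable (at x)" if "x \<in> S" for "is" x
  proof -
    have "fold partial (i # is) f differentiable (at x)"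
      using assms that unfolding smooth_on_def by blast
    then show ?thesis by simp
  qed
  with \<open>open S\<close> show "smooth_on S (partial i f)"
    by (simp add: smooth_on_def)
qed

lemma partial_eqI:
  assumes "(f has_derivative f') (at x)"
  shows "partial i f x = f' (axis i 1)"
  using frechet_derivative_at[OF assms] by (simp add: partial_def)

lemma differentiable_has_derivative:
  "f differentiable (at x) \<Longrightarrow> (f has_derivative frechet_derivative f (at x)) (at x)"
  by (simp add: frechet_derivative_works)

lemma partial_const [simp]: "partial i (\<lambda>_. c) = (\<lambda>_. 0)"
  by (rule ext) (rule partial_eqI[where f' = "\<lambda>_. 0", simplified], simp)

lemma partial_add:
  assumes "f differentiable (at x)" "g differentiable (at x)"
  shows "partial i (\<lambda>u. f u + g u) x = partial i f x + partial i g x"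
  using partial_eqI[OF has_derivative_add[OF assms[THEN differentiable_has_derivative]]]
  by (simp add: partial_def)

lemma partial_mult:
  assumes "f differentiable (at x)" "g differentiable (at x)"
  shows "partial i (\<lambda>u. f u * g u) x = f x * partial i g x + partial i f x * g x"
  using partial_eqI[OF has_derivative_mult[OF assms[THEN differentiable_has_derivative]]]
  by (simp add: partial_def)

lemma partial_transform:
  assumes "f differentiable (at x)" "open S" "x \<in> S" "\<And>u. u \<in> S \<Longrightarrow> f u = g u"
  shows "g differentiable (at x)" and "partial i g x = partial i f x"
proof -
  have "(g has_derivative frechet_derivative f (at x)) (at x)"
    using assms has_derivative_transform_within_open differentiable_has_derivative by metis
  then show "g differentiable (at x)" "partial i g x = partial i f x"
    using partial_eqI by (auto simp: differentiable_def partial_def)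
qed

lemma partial_component:
  fixes x :: "real^'n::finite"
  shows "(\<lambda>z. z $ j) differentiable (at x)"
    "partial i (\<lambda>z::real^'n. z $ j) = (\<lambda>_. if i = j then 1 else 0)"
proof -
  have *: "((\<lambda>z::real^'n. z $ j) has_derivative (\<lambda>z. z $ j)) (at x)" for x
    by (simp add: bounded_linear_imp_has_derivative bounded_linear_vec_nth)
  then show "(\<lambda>z::real^'n. z $ j) differentiable (at x)"
    by (auto simp: differentiable_def)
  show "partial i (\<lambda>z::real^'n. z $ j) = (\<lambda>_. if i = j then 1 else 0)"
    by (rule ext) (simp add: partial_eqI[OF *] axis_def)
qed

lemma bounded_linear_base_coords: "bounded_linear base_coords"
proof -
  have "linear (base_coords :: real^('n::finite + 'n) \<Rightarrow> real^'n)"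
    by (auto simp: base_coords_def linear_iff vec_eq_iff)
  then show ?thesis by (rule linear_conv_bounded_linear[THEN iffD1])
qed

lemma open_vimage_base_coords: "open V \<Longrightarrow> open (base_coords -` V)"
  by (rule open_vimage)
    (auto intro: linear_continuous_on bounded_linear_base_coords)

lemma partial_base_coords:
  fixes f :: "real^'n::finite \<Rightarrow> real"
  assumes "f differentiable (at (base_coords z))"
  shows "(\<lambda>u. f (base_coords u)) differentiable (at z)"
    and "partial (Inl i) (\<lambda>u. f (base_coords u)) z = partial i f (base_coords z)"
    and "partial (Inr i) (\<lambda>u. f (base_coords u)) z = 0"
proof -
  have *: "((\<lambda>u. f (base_coords u)) has_derivative
      (\<lambda>u. frechet_derivative f (at (base_coords z)) (base_coords u))) (at z)"
    by (rule has_derivative_compose[OF bounded_linear_imp_has_derivative[OF bounded_linear_base_coords]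
          differentiable_has_derivative[OF assms]])
  then show "(\<lambda>u. f (base_coords u)) differentiable (at z)"
    by (auto simp: differentiable_def)
  have l: "base_coords (axis (Inl i) 1) = (axis i 1 :: real^'n)"
    and r: "base_coords (axis (Inr i) 1) = (0 :: real^'n)"
    by (auto simp: base_coords_def axis_def vec_eq_iff)
  show "partial (Inl i) (\<lambda>u. f (base_coords u)) z = partial i f (base_coords z)"
    by (simp add: partial_eqI[OF *] l) (simp add: partial_def)
  interpret bounded_linear "frechet_derivative f (at (base_coords z))"
    using differentiable_has_derivative[OF assms] by (rule has_derivative_bounded_linear)
  show "partial (Inr i) (\<lambda>u. f (base_coords u)) z = 0"
    by (simp add: partial_eqI[OF *] r zero)
qed

subsection \<open>Leading parts\<close>

text \<open>
  \<open>leading_part V x0 d f f0\<close>: over \<open>V\<close>, the function \<open>f\<close> is a polynomial of degree at most \<open>d\<close> in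
  the fibre coordinates with smooth coefficients on the base, and \<open>f0\<close> is its part of degree
  exactly \<open>d\<close> with the coefficients frozen at \<open>x0\<close>.
\<close>

inductive leading_part ::
    "(real^'n::finite) set \<Rightarrow> real^'n \<Rightarrow> int \<Rightarrow> (real^('n + 'n) \<Rightarrow> real) \<Rightarrow> (real^('n + 'n) \<Rightarrow> real) \<Rightarrow> bool"
  for V x0 where
  coeff: "smooth_on V f \<Longrightarrow> leading_part V x0 0 (\<lambda>z. f (base_coords z)) (\<lambda>z. f x0)"
| fibre: "leading_part V x0 1 (\<lambda>z. z $ Inr i) (\<lambda>z. z $ Inr i)"
| zero: "leading_part V x0 d (\<lambda>z. 0) (\<lambda>z. 0)"
| add: "leading_part V x0 d f f0 \<Longrightarrow> leading_part V x0 d h h0 \<Longrightarrow>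
    leading_part V x0 d (\<lambda>z. f z + h z) (\<lambda>z. f0 z + h0 z)"
| mult: "leading_part V x0 d f f0 \<Longrightarrow> leading_part V x0 e h h0 \<Longrightarrow>
    leading_part V x0 (d + e) (\<lambda>z. f z * h z) (\<lambda>z. f0 z * h0 z)"
| lower: "leading_part V x0 d f f0 \<Longrightarrow> d < e \<Longrightarrow> leading_part V x0 e f (\<lambda>z. 0)"
| cong: "leading_part V x0 d f f0 \<Longrightarrow> (\<And>z. base_coords z \<in> V \<Longrightarrow> f z = h z) \<Longrightarrow>
    leading_part V x0 d h f0"

definition weight :: "'n + 'n \<Rightarrow> int" where
  "weight a = (case a of Inl _ \<Rightarrow> 1 | Inr _ \<Rightarrow> -1)"

lemma weight_simps [simp]: "weight (Inl i) = 1" "weight (Inr i) = -1"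
  by (simp_all add: weight_def)

lemma smooth_on_const:
  fixes V :: "(real^'n::finite) set"
  shows "open V \<Longrightarrow> smooth_on V (\<lambda>_. c)"
proof -
  have "\<exists>d. fold partial is (\<lambda>_. c) = (\<lambda>_. d)" for "is" :: "'n list" and c
    by (induction "is" arbitrary: c) auto
  then have "fold partial is (\<lambda>_. c) differentiable (at x)" for "is" :: "'n list" and x
    by (metis differentiable_const)
  then show "open V \<Longrightarrow> smooth_on V (\<lambda>_. c)"
    by (simp add: smooth_on_def)
qed

lemma leading_part_const: "open V \<Longrightarrow> leading_part V x0 0 (\<lambda>_. c) (\<lambda>_. c)"
  using leading_part.coeff[OF smooth_on_const] .

lemma leading_part_cmult:
  "open V \<Longrightarrow> leading_part V x0 d f f0 \<Longrightarrow> leading_part V x0 d (\<lambda>z. c * f z) (\<lambda>z. c * f0 z)"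
  using leading_part.mult[OF leading_part_const] by fastforce

lemma leading_part_diff:
  assumes "open V" "leading_part V x0 d f f0" "leading_part V x0 d h h0"
  shows "leading_part V x0 d (\<lambda>z. f z - h z) (\<lambda>z. f0 z - h0 z)"
  using leading_part.add[OF assms(2) leading_part_cmult[OF assms(1,3), where c = "-1"]] by simp

lemma leading_part_sum:
  assumes "\<And>i. i \<in> I \<Longrightarrow> leading_part V x0 d (f i) (f0 i)"
  shows "leading_part V x0 d (\<lambda>z. \<Sum>i\<in>I. f i z) (\<lambda>z. \<Sum>i\<in>I. f0 i z)"
  using assms
  by (induction I rule: infinite_finite_induct) (auto intro: leading_part.zero leading_part.add)

lemma leading_part_prod:
  assumes "open V" "\<And>i. i \<in> I \<Longrightarrow> leading_part V x0 (d i) (f i) (f0 i)"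
  shows "leading_part V x0 (\<Sum>i\<in>I. d i) (\<lambda>z. \<Prod>i\<in>I. f i z) (\<lambda>z. \<Prod>i\<in>I. f0 i z)"
  using assms(2)
  by (induction I rule: infinite_finite_induct)
    (auto intro: leading_part_const[OF assms(1)] leading_part.mult)

text \<open>Induction on the rules. Differentiability is carried along because the cases of sums and
  products need it to differentiate both \<open>f\<close> and \<open>f0\<close>.\<close>

lemma leading_part_partial:
  fixes f f0 :: "real^('n::finite + 'n) \<Rightarrow> real"
  assumes "leading_part V x0 d f f0" and V: "open V"
  shows "(\<forall>z. base_coords z \<in> V \<longrightarrow> f differentiable (at z)) \<and> (\<forall>z. f0 differentiable (at z)) \<and>
    (\<forall>a. leading_part V x0 (d + weight a) (partial a f) (partial a f0))"
  using assms(1)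
proof induction
  case (coeff f)
  have diff: "f differentiable (at x)" if "x \<in> V" for x
    using smooth_onD(2)[OF coeff that] .
  have "leading_part V x0 (0 + weight a) (partial a (\<lambda>z. f (base_coords z))) (\<lambda>z. 0)" for a
  proof (cases a)
    case (Inl i)
    have "leading_part V x0 (0 + weight a) (\<lambda>z. partial i f (base_coords z)) (\<lambda>z. 0)"
      using leading_part.lower[OF leading_part.coeff[OF smooth_onD(3)[OF coeff]]] Inl by simp
    then show ?thesis
      by (rule leading_part.cong) (simp add: Inl partial_base_coords diff)
  next
    case (Inr i)
    show ?thesis
      by (rule leading_part.cong[OF leading_part.zero]) (simp add: Inr partial_base_coords diff)
  qed
  then show ?case
    using partial_base_coords(1) diff by (auto simp del: add_0)
next
  case (fibre i)
  have "leading_part V x0 (1 + weight a) (\<lambda>z. if a = Inr i then 1 else 0) (\<lambda>z. if a = Inr i then 1 else 0)" for a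
    by (cases a) (auto intro: leading_part.zero leading_part_const[OF V])
  then show ?case
    by (auto simp: partial_component)
next
  case (add d f f0 h h0)
  have "leading_part V x0 (d + weight a) (partial a (\<lambda>z. f z + h z)) (partial a (\<lambda>z. f0 z + h0 z))" for a
  proof -
    have "leading_part V x0 (d + weight a) (partial a (\<lambda>z. f z + h z))
        (\<lambda>z. partial a f0 z + partial a h0 z)"
      by (rule leading_part.cong[OF leading_part.add[of V x0 _ "partial a f" _ "partial a h"]])
        (use add in \<open>auto simp: partial_add\<close>)
    also have "(\<lambda>z. partial a f0 z + partial a h0 z) = partial a (\<lambda>z. f0 z + h0 z)"
      using add by (auto simp: partial_add)
    finally show ?thesis .
  qed
  then show ?case using add by auto
next
  case (mult d f f0 e h h0)
  have "leading_part V x0 (d + e + weight a) (partial a (\<lambda>z. f z * h z)) (partial a (\<lambda>z. f0 z * h0 z))" for a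
  proof -
    have 1: "leading_part V x0 (d + (e + weight a)) (\<lambda>z. f z * partial a h z) (\<lambda>z. f0 z * partial a h0 z)"
      using mult by (intro leading_part.mult) auto
    have 2: "leading_part V x0 ((d + weight a) + e) (\<lambda>z. partial a f z * h z) (\<lambda>z. partial a f0 z * h0 z)"
      using mult by (intro leading_part.mult) auto
    have "leading_part V x0 (d + e + weight a) (\<lambda>z. f z * partial a h z + partial a f z * h z)
        (\<lambda>z. f0 z * partial a h0 z + partial a f0 z * h0 z)"
      using 1 2 by (intro leading_part.add) (simp_all add: algebra_simps)
    then have "leading_part V x0 (d + e + weight a) (partial a (\<lambda>z. f z * h z))
        (\<lambda>z. f0 z * partial a h0 z + partial a f0 z * h0 z)"
      by (rule leading_part.cong) (use mult in \<open>auto simp: partial_mult\<close>)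
    also have "(\<lambda>z. f0 z * partial a h0 z + partial a f0 z * h0 z) = partial a (\<lambda>z. f0 z * h0 z)"
      using mult by (auto simp: partial_mult)
    finally show ?thesis .
  qed
  then show ?case using mult by auto
next
  case (lower d f f0 e)
  then show ?case by (auto intro: leading_part.lower)
next
  case (cong d f f0 h)
  \<comment> \<open>The two functions agree on the preimage of \<open>V\<close>, which is open, so
    their derivatives agree there as well.\<close>
  have "h differentiable (at z) \<and> partial a h z = partial a f z" if "base_coords z \<in> V" for z a
    using partial_transform[OF _ open_vimage_base_coords[OF V], of f z h] cong that by auto
  moreover have "leading_part V x0 (d + weight a) (partial a h) (partial a f0)" for a
    by (rule leading_part.cong[of V x0 _ "partial a f"]) (use cong calculation in auto)
  ultimately show ?case using cong by auto
qed (auto intro: leading_part.zero)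

text \<open>Both claims go through one induction: if the bounds of two factors add up to 0, either
  both are 0 or one is negative, and then the product vanishes.\<close>

lemma leading_part_unique:
  assumes "leading_part V x0 d f f0" "base_coords z \<in> V"
  shows "(d < 0 \<longrightarrow> f z = 0 \<and> f0 z = 0) \<and> (d = 0 \<and> base_coords z = x0 \<longrightarrow> f z = f0 z)"
  using assms
proof induction
  case (mult d f f0 e h h0)
  then show ?case by (cases "d < 0"; cases "e < 0"; force)
qed auto

section \<open>Propagation of leading parts to curvature and its contractions\<close>

lemma leading_part_mult_eq:
  "leading_part V x0 d f f0 \<Longrightarrow> leading_part V x0 e h h0 \<Longrightarrow> d + e = k \<Longrightarrow>
    leading_part V x0 k (\<lambda>z. f z * h z) (\<lambda>z. f0 z * h0 z)"
  using leading_part.mult by blast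

lemma leading_part_partial_eq:
  "open V \<Longrightarrow> leading_part V x0 d f f0 \<Longrightarrow> d + weight a = k \<Longrightarrow>
    leading_part V x0 k (\<lambda>z. partial a f z) (\<lambda>z. partial a f0 z)"
  using leading_part_partial by blast

lemma sum_list_map_update:
  fixes f :: "'a \<Rightarrow> int"
  shows "s < length xs \<Longrightarrow> sum_list (map f (xs[s := m])) = sum_list (map f xs) - f (xs ! s) + f m"
  by (induction xs arbitrary: s) (auto split: nat.split)

lemma sum_pairs:
  fixes f :: "nat \<Rightarrow> 'a :: comm_monoid_add"
  shows "(\<Sum>j<n. f (2 * j) + f (2 * j + 1)) = (\<Sum>i<2 * n. f i)"
  by (induction n) (auto simp: algebra_simps)

text \<open>A lower index counts with its weight, an upper index with the opposite sign. The bound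
  on the inverse metric is an assumption here; for the extensions it is read off from the explicit
  inverse, which is again polynomial along the fibres.\<close>

locale metric_leading_part =
  fixes V :: "(real^'n::finite) set" and x0 :: "real^'n"
    and g g0 :: "real^('n + 'n) \<Rightarrow> real^('n + 'n)^('n + 'n)"
  assumes open_V: "open V"
    and metric: "\<And>a b. leading_part V x0 (weight a + weight b) (\<lambda>z. g z $ a $ b) (\<lambda>z. g0 z $ a $ b)"
    and inv: "\<And>a b. leading_part V x0 (- weight a - weight b)
      (\<lambda>z. metric_inv g z a b) (\<lambda>z. metric_inv g0 z a b)"
begin

abbreviation "lp \<equiv> leading_part V x0"

lemma levi_civita:
  "lp (weight i + weight j - weight k) (\<lambda>z. levi_civita g z i j k) (\<lambda>z. levi_civita g0 z i j k)"
  unfolding levi_civita_def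
  by (intro leading_part_cmult leading_part_sum leading_part_mult_eq[OF inv]
      leading_part_diff leading_part.add leading_part_partial_eq[OF open_V metric] open_V) (simp_all add: algebra_simps)

lemma curvature_op:
  "lp (weight i + weight j + weight k - weight l)
     (\<lambda>z. curvature_op g z i j k l) (\<lambda>z. curvature_op g0 z i j k l)"
  unfolding curvature_op_def
  by (intro leading_part_sum leading_part_mult_eq[OF levi_civita levi_civita]
      leading_part_diff leading_part.add leading_part_partial_eq[OF open_V levi_civita] open_V) simp_all

lemma riemann:
  "lp (weight i + weight j + weight k + weight l) (\<lambda>z. riemann g z i j k l) (\<lambda>z. riemann g0 z i j k l)"
  unfolding riemann_def
  by (intro leading_part_sum leading_part_mult_eq[OF metric curvature_op]) simp

lemma ricci: "lp (weight j + weight k) (\<lambda>z. ricci g z j k) (\<lambda>z. ricci g0 z j k)"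
  unfolding ricci_def
proof (intro leading_part_sum)
  \<comment> \<open>The traced index occurs once below and once above, so its weights
    cancel.\<close>
  show "lp (weight j + weight k) (\<lambda>z. curvature_op g z i j k i) (\<lambda>z. curvature_op g0 z i j k i)" for i
    using curvature_op[of i j k i] by simp
qed

lemma scalar_curvature: "lp 0 (scalar_curvature g) (scalar_curvature g0)"
  unfolding scalar_curvature_def by (intro leading_part_sum leading_part_mult_eq[OF inv ricci]) simp

lemma ricci_norm_sq: "lp 0 (ricci_norm_sq g) (ricci_norm_sq g0)"
  unfolding ricci_norm_sq_def
proof (intro leading_part_sum leading_part_mult_eq[OF ricci])
  fix i j a b
  show "lp (- weight i - weight j)
     (\<lambda>x. metric_inv g x i a * metric_inv g x j b * ricci g x a b)
     (\<lambda>x. metric_inv g0 x i a * metric_inv g0 x j b * ricci g0 x a b)"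
    by (intro leading_part_mult_eq[OF leading_part_mult_eq[OF inv inv refl] ricci]) simp
qed simp

lemma riemann_norm_sq: "lp 0 (riemann_norm_sq g) (riemann_norm_sq g0)"
  unfolding riemann_norm_sq_def
proof (intro leading_part_sum leading_part_mult_eq[OF riemann])
  fix i j k l a b c d
  show "lp (- weight i - weight j - weight k - weight l)
     (\<lambda>x. metric_inv g x i a * metric_inv g x j b * metric_inv g x k c * metric_inv g x l d
            * riemann g x a b c d)
     (\<lambda>x. metric_inv g0 x i a * metric_inv g0 x j b * metric_inv g0 x k c * metric_inv g0 x l d
            * riemann g0 x a b c d)"
    by (rule leading_part_mult_eq[OF leading_part_mult_eq[OF leading_part_mult_eq[OF
        leading_part_mult_eq[OF inv inv refl] inv refl] inv refl] riemann]) simp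
qed simp

lemma cov_deriv:
  assumes A: "\<And>is. length is = n \<Longrightarrow> lp (sum_list (map weight is)) (\<lambda>z. A z is) (\<lambda>z. A0 z is)"
    and "length is = Suc n"
  shows "lp (sum_list (map weight is)) (\<lambda>z. cov_deriv g A z is) (\<lambda>z. cov_deriv g0 A0 z is)"
proof -
  obtain k js where is_eq: "is = k # js" and len: "length js = n"
    using assms(2) by (cases "is") auto
  \<comment> \<open>The weight of \<open>m\<close> enters through \<open>A\<close> and leaves
    through the upper index of the Christoffel symbol, so the correction terms obey the same bound
    as the partial derivative.\<close>
  have "lp (weight k + sum_list (map weight js))
      (\<lambda>z. levi_civita g z k (js ! s) m * A z (js[s := m]))
      (\<lambda>z. levi_civita g0 z k (js ! s) m * A0 z (js[s := m]))" if "s < length js" for s m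
    using that len by (intro leading_part_mult_eq[OF levi_civita A]) (simp_all add: sum_list_map_update)
  moreover have "lp (weight k + sum_list (map weight js))
      (partial k (\<lambda>z. A z js)) (partial k (\<lambda>z. A0 z js))"
    by (rule leading_part_partial_eq[OF open_V A[OF len]]) simp
  ultimately show ?thesis
    unfolding is_eq by (simp, intro leading_part_diff leading_part_sum open_V) auto
qed

lemma nabla_riemann:
  "length is = k + 4 \<Longrightarrow>
    lp (sum_list (map weight is)) (\<lambda>z. nabla_riemann g k z is) (\<lambda>z. nabla_riemann g0 k z is)"
proof (induction k arbitrary: "is")
  case 0
  then obtain a b c d where "is = [a, b, c, d]"
    by (auto simp: numeral_eq_Suc length_Suc_conv)
  then show ?case
    using riemann[of a b c d] by (simp add: nabla_riemann_def riemann_tensor_def algebra_simps)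
next
  case (Suc k)
  then show ?case
    using cov_deriv[OF Suc.IH] by (simp add: nabla_riemann_def)
qed

lemma curvature_monomial:
  "length is = monomial_rank ks \<Longrightarrow>
    lp (sum_list (map weight is)) (\<lambda>z. curvature_monomial g ks z is) (\<lambda>z. curvature_monomial g0 ks z is)"
proof (induction ks arbitrary: "is")
  case Nil
  then show ?case by (simp add: monomial_rank_def leading_part_const open_V)
next
  case (Cons k ks)
  have "sum_list (map weight (take (k + 4) is)) + sum_list (map weight (drop (k + 4) is))
      = sum_list (map weight is)"
    by (metis append_take_drop_id map_append sum_list_append)
  then show ?case
    using Cons by (auto simp: monomial_rank_def intro!: leading_part_mult_eq[OF nabla_riemann])
qed

text \<open>Since \<sigma> is a permutation, the inverse metrics subtract the weight of every
  position exactly once, and the bound that remains is 0.\<close>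

lemma complete_contraction:
  assumes A: "\<And>is. length is = n \<Longrightarrow> lp (sum_list (map weight is)) (\<lambda>z. A z is) (\<lambda>z. A0 z is)"
    and "even n" and \<sigma>: "\<sigma> permutes {..<n}"
  shows "lp 0 (complete_contraction g n \<sigma> A) (complete_contraction g0 n \<sigma> A0)"
  unfolding complete_contraction_def
proof (intro leading_part_sum)
  fix "is" :: "('n + 'n) list"
  assume "is \<in> {is. length is = n}"
  then have len: "length is = n" by simp
  have "(\<Sum>j<n div 2. - weight (is ! \<sigma> (2 * j)) - weight (is ! \<sigma> (2 * j + 1)))
      = - (\<Sum>j<n div 2. weight (is ! \<sigma> (2 * j)) + weight (is ! \<sigma> (2 * j + 1)))"
    by (simp add: sum_negf[symmetric])
  also have "\<dots> = - (\<Sum>i<n. weight (is ! \<sigma> i))"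
    using sum_pairs[of "\<lambda>i. weight (is ! \<sigma> i)" "n div 2"] \<open>even n\<close> by simp
  also have "(\<Sum>i<n. weight (is ! \<sigma> i)) = (\<Sum>i<n. weight (is ! i))"
    using sum.permute[OF \<sigma>, of "\<lambda>i. weight (is ! i)"] by (simp add: o_def)
  also have "\<dots> = sum_list (map weight is)"
    using len by (simp add: sum_list_sum_nth atLeast0LessThan)
  finally have weights: "(\<Sum>j<n div 2. - weight (is ! \<sigma> (2 * j)) - weight (is ! \<sigma> (2 * j + 1)))
      = - sum_list (map weight is)" .
  show "lp 0
     (\<lambda>x. (\<Prod>j<n div 2. metric_inv g x (is ! \<sigma> (2 * j)) (is ! \<sigma> (2 * j + 1))) * A x is)
     (\<lambda>x. (\<Prod>j<n div 2. metric_inv g0 x (is ! \<sigma> (2 * j)) (is ! \<sigma> (2 * j + 1))) * A0 x is)"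
    by (rule leading_part_mult_eq[OF leading_part_prod[OF open_V inv] A[OF len]])
      (simp add: weights[simplified])
qed

end

subsection \<open>The frozen metric\<close>

lemma sum_UNIV_Plus:
  fixes f :: "'a::finite + 'b::finite \<Rightarrow> 'c::comm_monoid_add"
  shows "(\<Sum>a\<in>UNIV. f a) = (\<Sum>i\<in>UNIV. f (Inl i)) + (\<Sum>i\<in>UNIV. f (Inr i))"
  by (simp add: UNIV_Plus_UNIV[symmetric] sum.Plus del: UNIV_Plus_UNIV)

lemma matrix_inv_eqI:
  fixes A B :: "real^'n^'n"
  assumes "A ** B = mat 1" "B ** A = mat 1"
  shows "matrix_inv A = B"
proof -
  have "\<exists>C. A ** C = mat 1 \<and> C ** A = mat 1"
    using assms by blast
  then have C: "A ** matrix_inv A = mat 1 \<and> matrix_inv A ** A = mat 1"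
    unfolding matrix_inv_def by (rule someI_ex)
  then have "matrix_inv A = matrix_inv A ** (A ** B)"
    using assms by simp
  also have "\<dots> = B"
    using C by (simp add: matrix_mul_assoc)
  finally show ?thesis .
qed

lemma base_coords_nth [simp]: "base_coords z $ i = z $ Inl i"
  and fibre_coords_nth [simp]: "fibre_coords z $ i = z $ Inr i"
  by (simp_all add: base_coords_def fibre_coords_def)

lemma metric_inv_modified_riemannian_extension:
  fixes \<Gamma> :: "('c, 'n::finite) christoffel_field" and T \<Phi> :: "('c, 'n) matrix_field" and c :: 'c
  defines "g \<equiv> modified_riemannian_extension T \<Gamma> \<Phi> c"
  shows "metric_inv g z (Inl i) (Inl j) = 0"
    and "metric_inv g z (Inl i) (Inr j) = (if i = j then 1 else 0)"
    and "metric_inv g z (Inr i) (Inl j) = (if i = j then 1 else 0)"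
    and "metric_inv g z (Inr i) (Inr j) = - g z $ Inl i $ Inl j"
    and "(\<Sum>b\<in>UNIV. metric_inv g z a b * g z $ b $ d) = (if a = d then 1 else 0)"
proof -
  \<comment> \<open>In blocks ordered base, fibre, the metric is [[G, 1], [1, 0]] and
    \<open>B\<close> is [[0, 1], [1, -G]].\<close>
  define B :: "real^('n + 'n)^('n + 'n)" where "B = (\<chi> a b. case (a, b) of
     (Inl i, Inl j) \<Rightarrow> 0
   | (Inl i, Inr j) \<Rightarrow> if i = j then 1 else 0
   | (Inr i, Inl j) \<Rightarrow> if i = j then 1 else 0
   | (Inr i, Inr j) \<Rightarrow> - g z $ Inl i $ Inl j)"
  have B: "B $ Inl i $ Inl j = 0" "B $ Inl i $ Inr j = (if i = j then 1 else 0)"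
    "B $ Inr i $ Inl j = (if i = j then 1 else 0)" "B $ Inr i $ Inr j = - g z $ Inl i $ Inl j" for i j
    by (simp_all add: B_def)
  have g: "g z $ Inl i $ Inr j = (if i = j then 1 else 0)"
    "g z $ Inr i $ Inl j = (if i = j then 1 else 0)" "g z $ Inr i $ Inr j = 0" for i j
    by (simp_all add: g_def modified_riemannian_extension_def Let_def)
  have "(g z ** B) $ a $ b = mat 1 $ a $ b" for a b
    by ((cases a; cases b), simp_all add: B g matrix_matrix_mult_def mat_def sum_UNIV_Plus
        mult_delta_left mult_delta_right)
  moreover have "(B ** g z) $ a $ b = mat 1 $ a $ b" for a b
    by ((cases a; cases b), simp_all add: B g matrix_matrix_mult_def mat_def sum_UNIV_Plus
        mult_delta_left mult_delta_right sum_negf)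
  ultimately have "g z ** B = mat 1" and Bg: "B ** g z = mat 1"
    by (simp_all add: vec_eq_iff)
  then have inv: "matrix_inv (g z) = B"
    by (rule matrix_inv_eqI)
  then show "metric_inv g z (Inl i) (Inl j) = 0"
    "metric_inv g z (Inl i) (Inr j) = (if i = j then 1 else 0)"
    "metric_inv g z (Inr i) (Inl j) = (if i = j then 1 else 0)"
    "metric_inv g z (Inr i) (Inr j) = - g z $ Inl i $ Inl j"
    by (simp_all add: metric_inv_def B_def)
  have "(B ** g z) $ a $ d = mat 1 $ a $ d"
    by (simp add: Bg)
  then show "(\<Sum>b\<in>UNIV. metric_inv g z a b * g z $ b $ d) = (if a = d then 1 else 0)"
    by (simp add: matrix_matrix_mult_def mat_def metric_inv_def inv)
qed

text \<open>A single chart, named by the unit value, with flat connection and vanishing symmetric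
  tensor: only the constant pairing and the term quadratic in the fibre coordinates remain.\<close>

definition frozen_extension :: "real^'n^'n \<Rightarrow> real^('n::finite + 'n) \<Rightarrow> real^('n + 'n)^('n + 'n)" where
  "frozen_extension A = modified_riemannian_extension (\<lambda>_ _. A) (\<lambda>_ _ _ _ _. 0) (\<lambda>_ _. 0) ()"

text \<open>Components with two base indices have bound 2. The term in \<open>T\<close> is of degree
  2 and survives freezing; the terms in \<Gamma> and \<Phi> have degrees 1 and 0 and drop out. All
  other components of the metric are constant.\<close>

lemma metric_leading_part_frozen_extension:
  fixes \<Gamma> :: "('c, 'n::finite) christoffel_field"
  assumes "open V"
    and T: "\<And>r i. smooth_on V (\<lambda>x. T c x $ r $ i)"
    and \<Gamma>: "\<And>i j k. smooth_on V (\<lambda>x. \<Gamma> c x i j k)"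
    and \<Phi>: "\<And>i j. smooth_on V (\<lambda>x. \<Phi> c x $ i $ j)"
  shows "metric_leading_part V x0 (modified_riemannian_extension T \<Gamma> \<Phi> c) (frozen_extension (T c x0))"
proof
  let ?g = "modified_riemannian_extension T \<Gamma> \<Phi> c" and ?h = "frozen_extension (T c x0)"
  have 2: "leading_part V x0 2 (\<lambda>z. ?g z $ Inl i $ Inl j) (\<lambda>z. ?h z $ Inl i $ Inl j)" for i j
  proof -
    have quad: "leading_part V x0 2
       (\<lambda>z. 1/2 * (\<Sum>r\<in>UNIV. \<Sum>s\<in>UNIV. z $ Inr r * z $ Inr s *
             (T c (base_coords z) $ r $ i * T c (base_coords z) $ s $ j
               + T c (base_coords z) $ r $ j * T c (base_coords z) $ s $ i)))
       (\<lambda>z. 1/2 * (\<Sum>r\<in>UNIV. \<Sum>s\<in>UNIV. z $ Inr r * z $ Inr s *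
             (T c x0 $ r $ i * T c x0 $ s $ j + T c x0 $ r $ j * T c x0 $ s $ i)))"
      by (intro leading_part_cmult leading_part_sum \<open>open V\<close> leading_part.add
          leading_part_mult_eq[OF leading_part_mult_eq[OF leading_part.fibre leading_part.fibre refl]]
          leading_part_mult_eq[OF leading_part.coeff[OF T] leading_part.coeff[OF T]]) simp_all
    have lin: "leading_part V x0 2
        (\<lambda>z. 2 * (\<Sum>k\<in>UNIV. z $ Inr k * \<Gamma> c (base_coords z) i j k)) (\<lambda>z. 0)"
    proof (rule leading_part.lower[where d = 1])
      show "leading_part V x0 1 (\<lambda>z. 2 * (\<Sum>k\<in>UNIV. z $ Inr k * \<Gamma> c (base_coords z) i j k))
          (\<lambda>z. 2 * (\<Sum>k\<in>UNIV. z $ Inr k * \<Gamma> c x0 i j k))"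
        by (intro leading_part_cmult leading_part_sum \<open>open V\<close>
            leading_part_mult_eq[OF leading_part.fibre leading_part.coeff[OF \<Gamma>]]) simp
    qed simp
    have const: "leading_part V x0 2 (\<lambda>z. \<Phi> c (base_coords z) $ i $ j) (\<lambda>z. 0)"
      by (rule leading_part.lower[OF leading_part.coeff[OF \<Phi>]]) simp
    show ?thesis
      using leading_part.add[OF leading_part_diff[OF \<open>open V\<close> quad lin] const]
      by (simp add: modified_riemannian_extension_def frozen_extension_def Let_def)
  qed
  show "open V" by fact
  show "leading_part V x0 (weight a + weight b) (\<lambda>z. ?g z $ a $ b) (\<lambda>z. ?h z $ a $ b)" for a b
  proof (cases a; cases b)
    fix i j assume "a = Inl i" "b = Inl j"
    then show ?thesis using 2 by simp
  qed (auto simp: modified_riemannian_extension_def frozen_extension_def Let_def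
      leading_part_const leading_part.zero \<open>open V\<close>)
  show "leading_part V x0 (- weight a - weight b) (\<lambda>z. metric_inv ?g z a b) (\<lambda>z. metric_inv ?h z a b)" for a b
  proof (cases a; cases b)
    fix i j assume "a = Inr i" "b = Inr j"
    then show ?thesis
      using leading_part_cmult[OF \<open>open V\<close> 2, of "-1"]
      by (simp add: frozen_extension_def metric_inv_modified_riemannian_extension)
  qed (auto simp: frozen_extension_def metric_inv_modified_riemannian_extension
      leading_part_const leading_part.zero \<open>open V\<close>)
qed

section \<open>Complete contractions of tensors with values in a null space\<close>

text \<open>Exchanging the letter at position \<open>s\<close> with the extra letter is an
  involution on pairs of a list and a letter.\<close>

lemma sum_lists_update:
  fixes F :: "'a::finite list \<Rightarrow> real"
  assumes "s < n"
  shows "(\<Sum>is\<in>{is. length is = n}. \<Sum>a\<in>UNIV. F (is[s := a]))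
    = of_nat CARD('a) * (\<Sum>is\<in>{is. length is = n}. F is)"
proof -
  let ?L = "{is::'a list. length is = n}"
  have "(\<Sum>is\<in>?L. \<Sum>a\<in>UNIV. F (is[s := a])) = (\<Sum>(is, a)\<in>?L \<times> UNIV. F (is[s := a]))"
    by (simp add: sum.cartesian_product)
  also have "\<dots> = (\<Sum>(is, a)\<in>?L \<times> (UNIV::'a set). F is)"
    by (rule sum.reindex_bij_witness[where i = "\<lambda>(is, a). (is[s := a], is ! s)"
          and j = "\<lambda>(is, a). (is[s := a], is ! s)"]) (use assms in auto)
  also have "\<dots> = (\<Sum>is\<in>?L. \<Sum>a\<in>(UNIV::'a set). F is)"
    by (simp only: sum.cartesian_product)
  finally show ?thesis
    by (simp add: sum_distrib_left)
qed

lemma sum_swap4: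
  fixes f :: "'a \<Rightarrow> 'b \<Rightarrow> 'c \<Rightarrow> 'd \<Rightarrow> 'e::comm_monoid_add"
  shows "(\<Sum>a\<in>A. \<Sum>b\<in>B. \<Sum>c\<in>C. \<Sum>d\<in>D. f a b c d)
    = (\<Sum>c\<in>C. \<Sum>d\<in>D. \<Sum>a\<in>A. \<Sum>b\<in>B. f a b c d)"
proof -
  have "(\<Sum>a\<in>A. \<Sum>b\<in>B. \<Sum>c\<in>C. \<Sum>d\<in>D. f a b c d)
      = (\<Sum>a\<in>A. \<Sum>c\<in>C. \<Sum>b\<in>B. \<Sum>d\<in>D. f a b c d)"
    by (intro sum.cong refl sum.swap)
  also have "\<dots> = (\<Sum>c\<in>C. \<Sum>a\<in>A. \<Sum>b\<in>B. \<Sum>d\<in>D. f a b c d)"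
    by (rule sum.swap)
  also have "\<dots> = (\<Sum>c\<in>C. \<Sum>a\<in>A. \<Sum>d\<in>D. \<Sum>b\<in>B. f a b c d)"
    by (intro sum.cong refl sum.swap)
  also have "\<dots> = (\<Sum>c\<in>C. \<Sum>d\<in>D. \<Sum>a\<in>A. \<Sum>b\<in>B. f a b c d)"
    by (intro sum.cong refl sum.swap)
  finally show ?thesis .
qed

text \<open>
  \<open>P\<close> is to be thought of as a projection onto a totally null space of covectors that contains every
  index of \<open>A\<close>. The contraction of the two indices paired first by \<open>\<sigma>\<close> then vanishes already.
\<close>

lemma complete_contraction_eq_0:
  fixes P :: "'n::finite \<Rightarrow> 'n \<Rightarrow> real"
  assumes P: "\<And>is s. length is = n \<Longrightarrow> s < n \<Longrightarrow> A x is = (\<Sum>c\<in>UNIV. P (is ! s) c * A x (is[s := c]))"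
    and null: "\<And>c d. (\<Sum>a\<in>UNIV. \<Sum>b\<in>UNIV. metric_inv g x a b * P a c * P b d) = 0"
    and n: "even n" "n > 0" and \<sigma>: "\<sigma> permutes {..<n}"
  shows "complete_contraction g n \<sigma> A x = 0"
proof -
  let ?L = "{is::'n list. length is = n}"
  define F where "F = (\<lambda>is. (\<Prod>j<n div 2. metric_inv g x (is ! \<sigma> (2 * j)) (is ! \<sigma> (2 * j + 1))) * A x is)"
  define R where "R = (\<lambda>is. \<Prod>j\<in>{1..<n div 2}. metric_inv g x (is ! \<sigma> (2 * j)) (is ! \<sigma> (2 * j + 1)))"
  define s t where "s = \<sigma> 0" and "t = \<sigma> 1"
  have n2: "n \<ge> 2" using n by presburger
  have \<sigma>_less: "\<sigma> i < n" if "i < n" for i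
    using permutes_in_image[OF \<sigma>] that by auto
  have \<sigma>_eq: "\<sigma> i = \<sigma> j \<longleftrightarrow> i = j" for i j
    using permutes_inj[OF \<sigma>] by (auto dest: injD)
  have st: "s < n" "t < n" "s \<noteq> t"
    using n2 \<sigma>_less \<sigma>_eq by (auto simp: s_def t_def)
  have F: "F is = metric_inv g x (is ! s) (is ! t) * R is * A x is" for "is"
  proof -
    have "{..<n div 2} = insert 0 {1..<n div 2}" using n2 by auto
    then show ?thesis by (simp add: F_def R_def s_def t_def)
  qed
  have "(\<Sum>a\<in>UNIV. \<Sum>b\<in>UNIV. F (is[s := a, t := b])) = 0" if "is \<in> ?L" for "is"
  proof -
    have len: "length is = n" using that by simp
    \<comment> \<open>The remaining factors read positions other than \<open>s\<close> and
      \<open>t\<close>.\<close>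
    have R: "R (is[s := a, t := b]) = R is" for a b
      unfolding R_def
    proof (rule prod.cong)
      fix j assume "j \<in> {1..<n div 2}"
      then have "\<sigma> (2 * j) \<noteq> s" "\<sigma> (2 * j) \<noteq> t" "\<sigma> (2 * j + 1) \<noteq> s" "\<sigma> (2 * j + 1) \<noteq> t"
        unfolding s_def t_def \<sigma>_eq by auto
      then show "metric_inv g x (is[s := a, t := b] ! \<sigma> (2 * j)) (is[s := a, t := b] ! \<sigma> (2 * j + 1))
          = metric_inv g x (is ! \<sigma> (2 * j)) (is ! \<sigma> (2 * j + 1))"
        by simp
    qed simp
    \<comment> \<open>Expanding both paired positions through \<open>P\<close> exposes the
      contraction of two copies of \<open>P\<close> that \<open>null\<close> makes vanish.\<close>
    have A: "A x (is[s := a, t := b]) = (\<Sum>c\<in>UNIV. \<Sum>d\<in>UNIV. P a c * P b d * A x (is[s := c, t := d]))" for a b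
    proof -
      have 1: "A x (is[s := a, t := b]) = (\<Sum>c\<in>UNIV. P a c * A x (is[s := c, t := b]))"
        using P[of "is[s := a, t := b]" s] st len by (simp add: list_update_swap)
      have 2: "A x (is[s := c, t := b]) = (\<Sum>d\<in>UNIV. P b d * A x (is[s := c, t := d]))" for c
        using P[of "is[s := c, t := b]" t] st len by simp
      show ?thesis
        unfolding 1 by (subst 2) (simp only: sum_distrib_left mult.assoc)
    qed
    have "F (is[s := a, t := b]) = (\<Sum>c\<in>UNIV. \<Sum>d\<in>UNIV.
        metric_inv g x a b * P a c * P b d * (R is * A x (is[s := c, t := d])))" for a b
    proof -
      have "F (is[s := a, t := b]) = metric_inv g x a b * R is * A x (is[s := a, t := b])"
        using st len by (simp add: F R)
      then show ?thesis
        unfolding A[of a b] by (simp add: sum_distrib_left mult_ac)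
    qed
    then have "(\<Sum>a\<in>UNIV. \<Sum>b\<in>UNIV. F (is[s := a, t := b])) =
        (\<Sum>a\<in>UNIV. \<Sum>b\<in>UNIV. \<Sum>c\<in>UNIV. \<Sum>d\<in>UNIV.
          metric_inv g x a b * P a c * P b d * (R is * A x (is[s := c, t := d])))"
      by simp
    also have "\<dots> = (\<Sum>c\<in>UNIV. \<Sum>d\<in>UNIV. \<Sum>a\<in>UNIV. \<Sum>b\<in>UNIV.
          metric_inv g x a b * P a c * P b d * (R is * A x (is[s := c, t := d])))"
      by (rule sum_swap4)
    also have "\<dots> = 0"
      unfolding sum_distrib_right[symmetric] null by simp
    finally show ?thesis .
  qed
  then have "(\<Sum>is\<in>?L. \<Sum>a\<in>UNIV. \<Sum>b\<in>UNIV. F (is[s := a, t := b])) = 0"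
    by simp
  \<comment> \<open>The additional summation over the letters at \<open>s\<close> and
    \<open>t\<close> merely multiplies the whole sum by the square of the number of indices, which
    is not zero.\<close>
  then have "(\<Sum>is\<in>?L. F is) = 0"
    using sum_lists_update[OF st(1), of "\<lambda>is. \<Sum>b\<in>UNIV. F (is[t := b])"] sum_lists_update[OF st(2), of F]
    by simp
  then show ?thesis
    by (simp add: complete_contraction_def F_def)
qed

definition dual_index :: "'n + 'n \<Rightarrow> 'n + 'n" where
  "dual_index a = (case a of Inl i \<Rightarrow> Inr i | Inr i \<Rightarrow> Inl i)"

lemma dual_index_simps [simp]:
  "dual_index (Inl i) = Inr i" "dual_index (Inr i) = Inl i" "dual_index (dual_index a) = a"
  by (simp_all add: dual_index_def split: sum.split)

lemma sum_dual_index [simp]: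
  fixes f :: "'n::finite + 'n \<Rightarrow> real"
  shows "(\<Sum>l\<in>UNIV. (if l = dual_index k then 1 else 0) * f l) = f (dual_index k)"
  by (simp add: mult_delta_left)

definition fibre_form :: "real^'n^'n \<Rightarrow> real^('n::finite + 'n) \<Rightarrow> 'n + 'n \<Rightarrow> real" where
  "fibre_form A z a = (case a of Inl i \<Rightarrow> \<Sum>r\<in>UNIV. A $ r $ i * z $ Inr r | Inr _ \<Rightarrow> 0)"

definition fibre_form_deriv :: "real^'n^'n \<Rightarrow> 'n + 'n \<Rightarrow> 'n + 'n \<Rightarrow> real" where
  "fibre_form_deriv A p a = (case (p, a) of (Inr r, Inl i) \<Rightarrow> A $ r $ i | _ \<Rightarrow> 0)"

lemma fibre_form_deriv_simps [simp]:
  "fibre_form_deriv A (Inr r) (Inl i) = A $ r $ i"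
  "fibre_form_deriv A (Inl j) a = 0"
  "fibre_form_deriv A p (Inr j) = 0"
  by (simp_all add: fibre_form_deriv_def split: sum.split)

lemma partial_fibre_form:
  "(\<lambda>z. fibre_form A z a) differentiable (at z)"
  "partial p (\<lambda>z. fibre_form A z a) = (\<lambda>_. fibre_form_deriv A p a)"
proof -
  have "((\<lambda>z. fibre_form A z a) has_derivative (\<lambda>v. fibre_form A v a)) (at z)" for z
    by (cases a) (auto simp: fibre_form_def intro!: derivative_eq_intros has_derivative_sum
      bounded_linear_imp_has_derivative[OF bounded_linear_vec_nth])
  note * = this
  then show "(\<lambda>z. fibre_form A z a) differentiable (at z)"
    by (auto simp: differentiable_def)
  show "partial p (\<lambda>z. fibre_form A z a) = (\<lambda>_. fibre_form_deriv A p a)"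
    by (rule ext, subst partial_eqI[OF *], cases a; cases p)
      (auto simp: fibre_form_def fibre_form_deriv_def axis_def mult_delta_right)
qed

lemma frozen_extension_nth:
  "frozen_extension A z $ a $ b = (if b = dual_index a then 1 else 0) + fibre_form A z a * fibre_form A z b"
proof (cases a; cases b)
  fix i j assume ab: "a = Inl i" "b = Inl j"
  have "1/2 * (\<Sum>r\<in>UNIV. \<Sum>s\<in>UNIV. z $ Inr r * z $ Inr s * (A $ r $ i * A $ s $ j + A $ r $ j * A $ s $ i))
    = 1/2 * ((\<Sum>r\<in>UNIV. A $ r $ i * z $ Inr r) * (\<Sum>s\<in>UNIV. A $ s $ j * z $ Inr s)
      + (\<Sum>r\<in>UNIV. A $ r $ j * z $ Inr r) * (\<Sum>s\<in>UNIV. A $ s $ i * z $ Inr s))"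
    by (simp only: sum_product sum.distrib[symmetric]) (simp add: algebra_simps)
  then show ?thesis
    by (simp add: ab frozen_extension_def modified_riemannian_extension_def Let_def fibre_form_def)
qed (auto simp: frozen_extension_def modified_riemannian_extension_def Let_def fibre_form_def)

lemma partial_frozen_extension:
  "partial p (\<lambda>z. frozen_extension A z $ a $ b) =
    (\<lambda>z. fibre_form_deriv A p a * fibre_form A z b + fibre_form A z a * fibre_form_deriv A p b)"
proof
  fix z
  show "partial p (\<lambda>z. frozen_extension A z $ a $ b) z =
      fibre_form_deriv A p a * fibre_form A z b + fibre_form A z a * fibre_form_deriv A p b"
    unfolding frozen_extension_nth
    by (simp add: partial_add partial_mult differentiable_mult partial_fibre_form)
qed

text \<open>The rank one correction is null for the constant pairing, so inversion only reverses its
  sign.\<close>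

lemma metric_inv_frozen_extension:
  "metric_inv (frozen_extension A) z a b =
    (if b = dual_index a then 1 else 0) - fibre_form A z (dual_index a) * fibre_form A z (dual_index b)"
proof (cases a; cases b)
  fix i j assume ab: "a = Inr i" "b = Inr j"
  then have "metric_inv (frozen_extension A) z a b = - frozen_extension A z $ Inl i $ Inl j"
    by (simp add: frozen_extension_def metric_inv_modified_riemannian_extension)
  then show ?thesis
    by (simp add: ab frozen_extension_nth)
qed (auto simp: frozen_extension_def metric_inv_modified_riemannian_extension fibre_form_def)

lemma levi_civita_frozen_extension:
  "levi_civita (frozen_extension A) z i j k = (1/2) * (\<Sum>l\<in>UNIV. metric_inv (frozen_extension A) z k l *
     ((fibre_form_deriv A i j + fibre_form_deriv A j i) * fibre_form A z l
      + (fibre_form_deriv A i l - fibre_form_deriv A l i) * fibre_form A z j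
      + (fibre_form_deriv A j l - fibre_form_deriv A l j) * fibre_form A z i))"
  unfolding levi_civita_def partial_frozen_extension
  by (intro arg_cong2[where f = "(*)"] sum.cong refl) (simp add: algebra_simps)

subsection \<open>The frozen metric of a nilpotent endomorphism\<close>

text \<open>The condition \<open>uv\<close> makes the square of u \<otimes> v vanish. The vectors
  may be zero, so the zero matrix is covered.\<close>

locale nilpotent_frozen =
  fixes A :: "real^'n^'n::finite" and u v :: "real^'n"
  assumes A: "\<And>r i. A $ r $ i = u $ r * v $ i"
    and uv: "(\<Sum>i\<in>UNIV. u $ i * v $ i) = 0"
begin

text \<open>With h = u^r y_r, these are \<beta> = v_i dx^i, \<eta> = dh and the wedge product
  \<omega> of \<eta> and \<beta>. The fibre form is h times \<beta>.\<close>

definition \<beta> :: "'n + 'n \<Rightarrow> real" where "\<beta> a = (case a of Inl i \<Rightarrow> v $ i | Inr _ \<Rightarrow> 0)"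
definition \<eta> :: "'n + 'n \<Rightarrow> real" where "\<eta> a = (case a of Inl _ \<Rightarrow> 0 | Inr i \<Rightarrow> u $ i)"
definition \<omega> :: "'n + 'n \<Rightarrow> 'n + 'n \<Rightarrow> real" where "\<omega> a b = \<eta> a * \<beta> b - \<eta> b * \<beta> a"
definition h :: "real^('n + 'n) \<Rightarrow> real" where "h z = (\<Sum>r\<in>UNIV. u $ r * z $ Inr r)"

abbreviation "g \<equiv> frozen_extension A"

lemma fibre_form_eq: "fibre_form A z a = h z * \<beta> a"
  by (cases a) (simp_all add: fibre_form_def A h_def \<beta>_def sum_distrib_left sum_distrib_right mult_ac)

lemma fibre_form_deriv_eq: "fibre_form_deriv A p a = \<eta> p * \<beta> a"
  by (cases a; cases p) (simp_all add: \<beta>_def \<eta>_def A)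

lemma partial_h: "h differentiable (at z)" "partial p h = (\<lambda>_. \<eta> p)"
proof -
  have "(h has_derivative h) (at z)" for z
    by (auto simp: h_def [abs_def] intro!: derivative_eq_intros has_derivative_sum
      bounded_linear_imp_has_derivative[OF bounded_linear_vec_nth])
  note * = this
  then show "h differentiable (at z)"
    by (auto simp: differentiable_def)
  show "partial p h = (\<lambda>_. \<eta> p)"
    by (rule ext, subst partial_eqI[OF *], cases p) (auto simp: h_def \<eta>_def axis_def mult_delta_right)
qed

text \<open>Pairings of a form with itself vanish because its nonzero components are all of one
  kind, base or fibre; mixed pairings reduce to \<open>uv\<close>.\<close>

lemma contractions [simp]:
  "(\<Sum>a\<in>UNIV. \<beta> a * \<beta> (dual_index a)) = 0" "(\<Sum>a\<in>UNIV. \<beta> (dual_index a) * \<beta> a) = 0"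
  "(\<Sum>a\<in>UNIV. \<beta> a * \<eta> (dual_index a)) = 0" "(\<Sum>a\<in>UNIV. \<eta> (dual_index a) * \<beta> a) = 0"
  "(\<Sum>a\<in>UNIV. \<eta> a * \<beta> (dual_index a)) = 0" "(\<Sum>a\<in>UNIV. \<beta> (dual_index a) * \<eta> a) = 0"
  "(\<Sum>a\<in>UNIV. \<eta> a * \<eta> (dual_index a)) = 0" "(\<Sum>a\<in>UNIV. \<eta> (dual_index a) * \<eta> a) = 0"
  using uv by (simp_all add: sum_UNIV_Plus \<beta>_def \<eta>_def mult.commute)

lemma metric_inv_eq:
  "metric_inv g z a b = (if b = dual_index a then 1 else 0) - (h z)\<^sup>2 * \<beta> (dual_index a) * \<beta> (dual_index b)"
  by (simp add: metric_inv_frozen_extension fibre_form_eq power2_eq_square)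

text \<open>The correction to the inverse metric contracts to 0 with both forms, so raising their
  index only involves the constant pairing.\<close>

lemma raise:
  "(\<Sum>l\<in>UNIV. metric_inv g z k l * \<beta> l) = \<beta> (dual_index k)"
  "(\<Sum>l\<in>UNIV. metric_inv g z k l * \<eta> l) = \<eta> (dual_index k)"
  unfolding metric_inv_eq left_diff_distrib sum_subtractf mult.assoc sum_distrib_left[symmetric] by simp_all

lemma levi_civita_eq:
  "levi_civita g z i j k = h z * (\<eta> i * \<beta> j * \<beta> (dual_index k) + \<eta> j * \<beta> i * \<beta> (dual_index k)
     - \<beta> i * \<beta> j * \<eta> (dual_index k))"
proof -
  have "levi_civita g z i j k = (1/2) * (\<Sum>l\<in>UNIV.
      (2 * h z * (\<eta> i * \<beta> j + \<eta> j * \<beta> i)) * (metric_inv g z k l * \<beta> l)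
      - (2 * h z * \<beta> i * \<beta> j) * (metric_inv g z k l * \<eta> l))"
    unfolding levi_civita_frozen_extension fibre_form_eq fibre_form_deriv_eq
    by (intro arg_cong2[where f = "(*)"] sum.cong refl) (simp add: algebra_simps)
  then show ?thesis
    unfolding sum_subtractf sum_distrib_left[symmetric] raise by (simp add: algebra_simps)
qed

text \<open>The upper index of the symbol lies in the span of the raised forms \<beta> and \<eta>,
  which are null and orthogonal. As \<beta> and \<eta> have constant components, they are
  parallel.\<close>

lemma levi_civita_contract:
  "(\<Sum>m\<in>UNIV. levi_civita g z i j m * \<beta> m) = 0"
  "(\<Sum>m\<in>UNIV. levi_civita g z i j m * \<eta> m) = 0"
  unfolding levi_civita_eq left_diff_distrib distrib_right right_diff_distrib distrib_left
    sum_subtractf sum.distrib mult.assoc sum_distrib_left[symmetric] by simp_all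

lemma levi_civita_\<omega>: "(\<Sum>m\<in>UNIV. levi_civita g z i j m * \<omega> m q) = 0"
  "(\<Sum>m\<in>UNIV. levi_civita g z i j m * \<omega> q m) = 0"
proof -
  have "(\<Sum>m\<in>UNIV. levi_civita g z i j m * \<omega> m q) =
      (\<Sum>m\<in>UNIV. levi_civita g z i j m * \<eta> m) * \<beta> q - \<eta> q * (\<Sum>m\<in>UNIV. levi_civita g z i j m * \<beta> m)"
    by (simp add: \<omega>_def sum_subtractf sum_distrib_left sum_distrib_right algebra_simps)
  then show *: "(\<Sum>m\<in>UNIV. levi_civita g z i j m * \<omega> m q) = 0"
    by (simp add: levi_civita_contract)
  have "\<omega> q m = - \<omega> m q" for m by (simp add: \<omega>_def)
  then show "(\<Sum>m\<in>UNIV. levi_civita g z i j m * \<omega> q m) = 0"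
    using * by (simp add: sum_negf)
qed

text \<open>Removes the quadratic terms of the curvature. What remains comes from differentiating
  the factor h in the Christoffel symbols.\<close>

lemma levi_civita_levi_civita: "(\<Sum>m\<in>UNIV. levi_civita g z i m l * levi_civita g z j k m) = 0"
proof -
  have "(\<Sum>m\<in>UNIV. levi_civita g z i m l * levi_civita g z j k m) =
     (h z * \<eta> i * \<beta> (dual_index l) - h z * \<beta> i * \<eta> (dual_index l)) * (\<Sum>m\<in>UNIV. levi_civita g z j k m * \<beta> m)
     + h z * \<beta> i * \<beta> (dual_index l) * (\<Sum>m\<in>UNIV. levi_civita g z j k m * \<eta> m)"
    unfolding levi_civita_eq[of z i]
    by (simp add: sum_distrib_left sum.distrib[symmetric] algebra_simps)
  then show ?thesis
    by (simp add: levi_civita_contract)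
qed

lemma curvature_op_eq:
  "curvature_op g z i j k l = \<omega> i j * (\<eta> k * \<beta> (dual_index l) - \<beta> k * \<eta> (dual_index l))"
proof -
  have "partial p (\<lambda>z. levi_civita g z i j k) z = \<eta> p * (\<eta> i * \<beta> j * \<beta> (dual_index k) + \<eta> j * \<beta> i * \<beta> (dual_index k)
     - \<beta> i * \<beta> j * \<eta> (dual_index k))" for p i j k
    unfolding levi_civita_eq by (simp add: partial_mult partial_h)
  then show ?thesis
    unfolding curvature_op_def sum_subtractf levi_civita_levi_civita
    by (simp add: \<omega>_def algebra_simps)
qed

lemma riemann_eq: "riemann g z i j k l = \<omega> i j * \<omega> k l"
proof -
  have "riemann g z i j k l =
      \<omega> i j * \<eta> k * ((\<Sum>m\<in>UNIV. (if m = dual_index l then 1 else 0) * \<beta> (dual_index m))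
          + (h z)\<^sup>2 * \<beta> l * (\<Sum>m\<in>UNIV. \<beta> m * \<beta> (dual_index m)))
      - \<omega> i j * \<beta> k * ((\<Sum>m\<in>UNIV. (if m = dual_index l then 1 else 0) * \<eta> (dual_index m))
          + (h z)\<^sup>2 * \<beta> l * (\<Sum>m\<in>UNIV. \<beta> m * \<eta> (dual_index m)))"
    unfolding riemann_def frozen_extension_nth fibre_form_eq curvature_op_eq
    unfolding sum_distrib_left sum.distrib[symmetric] sum_subtractf[symmetric]
    by (rule sum.cong) (simp_all add: power2_eq_square algebra_simps)
  then show ?thesis
    unfolding sum_dual_index by (simp add: \<omega>_def algebra_simps)
qed

lemma ricci_eq: "ricci g z j k = 0"
proof -
  have "ricci g z j k = \<beta> j * \<eta> k * (\<Sum>m\<in>UNIV. \<eta> m * \<beta> (dual_index m))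
      - \<beta> j * \<beta> k * (\<Sum>m\<in>UNIV. \<eta> m * \<eta> (dual_index m))
      - \<eta> j * \<eta> k * (\<Sum>m\<in>UNIV. \<beta> m * \<beta> (dual_index m))
      + \<eta> j * \<beta> k * (\<Sum>m\<in>UNIV. \<beta> m * \<eta> (dual_index m))"
    unfolding ricci_def curvature_op_eq \<omega>_def
    unfolding sum_distrib_left sum.distrib[symmetric] sum_subtractf[symmetric]
    by (rule sum.cong) (simp_all add: algebra_simps)
  then show ?thesis by simp
qed

lemma nabla_riemann_0:
  "length is = 4 \<Longrightarrow> nabla_riemann g 0 z is = \<omega> (is ! 0) (is ! 1) * \<omega> (is ! 2) (is ! 3)"
  by (simp add: nabla_riemann_def riemann_tensor_def riemann_eq)

text \<open>The curvature is \<omega> \<otimes> \<omega> with constant components, and every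
  Christoffel correction contracts one slot of \<omega> to 0. Hence the first covariant derivative
  vanishes, and with it all later ones.\<close>

lemma nabla_riemann_Suc: "length is = Suc k + 4 \<Longrightarrow> nabla_riemann g (Suc k) z is = 0"
proof (induction k arbitrary: "is" z)
  case 0
  then obtain p a b c d where is_eq: "is = [p, a, b, c, d]"
    by (auto simp: numeral_eq_Suc length_Suc_conv)
  have *: "riemann_tensor g z [a, b, c, d] = \<omega> a b * \<omega> c d" for z a b c d
    by (simp add: riemann_tensor_def riemann_eq)
  have "(\<Sum>m\<in>UNIV. levi_civita g z p a m * (\<omega> m b * \<omega> c d)) = 0"
    "(\<Sum>m\<in>UNIV. levi_civita g z p b m * (\<omega> a m * \<omega> c d)) = 0"
    "(\<Sum>m\<in>UNIV. levi_civita g z p c m * (\<omega> a b * \<omega> m d)) = 0"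
    "(\<Sum>m\<in>UNIV. levi_civita g z p d m * (\<omega> a b * \<omega> c m)) = 0"
    unfolding mult.assoc[symmetric] sum_distrib_right[symmetric]
    unfolding mult.commute[of _ "\<omega> a b"] mult.assoc[of "\<omega> a b"] sum_distrib_left[symmetric]
    by (simp_all add: levi_civita_\<omega>)
  then show ?case
    by (simp add: nabla_riemann_def is_eq * numeral_eq_Suc)
next
  case (Suc k)
  then obtain p js where is_eq: "is = p # js" and len: "length js = Suc k + 4"
    by (cases "is") auto
  have "nabla_riemann g (Suc k) z js = 0" "nabla_riemann g (Suc k) z (js[s := m]) = 0" for s m z
    using Suc.IH len by simp_all
  moreover have "nabla_riemann g (Suc (Suc k)) = cov_deriv g (nabla_riemann g (Suc k))"
    by (simp add: nabla_riemann_def)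
  ultimately show ?case
    by (simp add: is_eq)
qed

text \<open>
  The projection onto the span of \<open>\<beta>\<close> and \<open>\<eta>\<close>. If \<open>v = 0\<close> then \<open>\<beta> = 0\<close>, so the division by zero
  does no harm, and likewise for \<open>u\<close>.
\<close>

definition P :: "'n + 'n \<Rightarrow> 'n + 'n \<Rightarrow> real" where
  "P a c = \<beta> a * (\<beta> c / (v \<bullet> v)) + \<eta> a * (\<eta> c / (u \<bullet> u))"

lemma P_contract: "(\<Sum>c\<in>UNIV. P a c * \<beta> c) = \<beta> a" "(\<Sum>c\<in>UNIV. P a c * \<eta> c) = \<eta> a"
proof -
  \<comment> \<open>No cross terms arise, since \<beta> is supported on base indices and \<eta> on
    fibre indices.\<close>
  have "(\<Sum>c\<in>UNIV. P a c * \<beta> c) = (\<Sum>i\<in>UNIV. \<beta> a / (v \<bullet> v) * (v $ i * v $ i))"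
    by (simp add: sum_UNIV_Plus P_def \<beta>_def[of "Inl _"] \<beta>_def[of "Inr _"] \<eta>_def[of "Inl _"] \<eta>_def[of "Inr _"] mult.assoc)
  also have "\<dots> = \<beta> a / (v \<bullet> v) * (v \<bullet> v)"
    by (simp only: sum_distrib_left inner_vec_def inner_real_def mult.assoc)
  finally show "(\<Sum>c\<in>UNIV. P a c * \<beta> c) = \<beta> a"
    unfolding \<beta>_def by (cases "v = 0") (auto split: sum.split)
  have "(\<Sum>c\<in>UNIV. P a c * \<eta> c) = (\<Sum>i\<in>UNIV. \<eta> a / (u \<bullet> u) * (u $ i * u $ i))"
    by (simp add: sum_UNIV_Plus P_def \<beta>_def[of "Inl _"] \<beta>_def[of "Inr _"] \<eta>_def[of "Inl _"] \<eta>_def[of "Inr _"] mult.assoc)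
  also have "\<dots> = \<eta> a / (u \<bullet> u) * (u \<bullet> u)"
    by (simp only: sum_distrib_left inner_vec_def inner_real_def mult.assoc)
  finally show "(\<Sum>c\<in>UNIV. P a c * \<eta> c) = \<eta> a"
    unfolding \<eta>_def by (cases "u = 0") (auto split: sum.split)
qed

lemma P_\<omega>: "(\<Sum>c\<in>UNIV. P a c * \<omega> c q) = \<omega> a q" "(\<Sum>c\<in>UNIV. P a c * \<omega> q c) = \<omega> q a"
proof -
  have "(\<Sum>c\<in>UNIV. P a c * \<omega> c q) = (\<Sum>c\<in>UNIV. P a c * \<eta> c) * \<beta> q - \<eta> q * (\<Sum>c\<in>UNIV. P a c * \<beta> c)"
    by (simp add: \<omega>_def sum_subtractf sum_distrib_left sum_distrib_right algebra_simps)
  then show *: "(\<Sum>c\<in>UNIV. P a c * \<omega> c q) = \<omega> a q"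
    by (simp add: P_contract \<omega>_def)
  have "\<omega> q c = - \<omega> c q" for c by (simp add: \<omega>_def)
  then show "(\<Sum>c\<in>UNIV. P a c * \<omega> q c) = \<omega> q a"
    using * by (simp add: sum_negf)
qed

text \<open>The image of \<open>P\<close> is spanned by \<beta> and \<eta>, so only their four
  mutual pairings occur, and these are all 0.\<close>

lemma P_null: "(\<Sum>a\<in>UNIV. \<Sum>b\<in>UNIV. metric_inv g z a b * P a c * P b d) = 0"
proof -
  have "(\<Sum>b\<in>UNIV. metric_inv g z a b * P b d)
      = \<beta> (dual_index a) * (\<beta> d / (v \<bullet> v)) + \<eta> (dual_index a) * (\<eta> d / (u \<bullet> u))" for a
    unfolding raise[symmetric, of a z] sum_distrib_right sum.distrib[symmetric]
    by (rule sum.cong) (simp_all add: P_def algebra_simps)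
  then have *: "P a c * (\<Sum>b\<in>UNIV. metric_inv g z a b * P b d)
      = (\<beta> a * \<beta> (dual_index a)) * (\<beta> c / (v \<bullet> v) * (\<beta> d / (v \<bullet> v)))
      + (\<beta> a * \<eta> (dual_index a)) * (\<beta> c / (v \<bullet> v) * (\<eta> d / (u \<bullet> u)))
      + (\<eta> a * \<beta> (dual_index a)) * (\<eta> c / (u \<bullet> u) * (\<beta> d / (v \<bullet> v)))
      + (\<eta> a * \<eta> (dual_index a)) * (\<eta> c / (u \<bullet> u) * (\<eta> d / (u \<bullet> u)))" for a
    by (simp add: P_def algebra_simps)
  have "(\<Sum>a\<in>UNIV. \<Sum>b\<in>UNIV. metric_inv g z a b * P a c * P b d)
      = (\<Sum>a\<in>UNIV. P a c * (\<Sum>b\<in>UNIV. metric_inv g z a b * P b d))"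
    by (simp add: sum_distrib_left mult_ac)
  also have "\<dots> = 0"
    unfolding * sum.distrib sum_distrib_right[symmetric] by simp
  finally show ?thesis .
qed

text \<open>At order 0 every slot belongs to a factor \<omega>, which \<open>P\<close> fixes; at
  positive order both sides are 0.\<close>

lemma P_nabla_riemann:
  assumes "length is = k + 4" "s < k + 4"
  shows "nabla_riemann g k z is = (\<Sum>c\<in>UNIV. P (is ! s) c * nabla_riemann g k z (is[s := c]))"
proof (cases k)
  case 0
  have 1: "(\<Sum>c\<in>UNIV. P a c * (\<omega> c b * x)) = \<omega> a b * x" "(\<Sum>c\<in>UNIV. P a c * (\<omega> b c * x)) = \<omega> b a * x"
    "(\<Sum>c\<in>UNIV. P a c * (x * \<omega> c b)) = x * \<omega> a b" "(\<Sum>c\<in>UNIV. P a c * (x * \<omega> b c)) = x * \<omega> b a" for a b x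
    unfolding P_\<omega>[of a b, symmetric] by (simp_all add: sum_distrib_left sum_distrib_right mult_ac)
  have "s = 0 \<or> s = 1 \<or> s = 2 \<or> s = 3" using assms 0 by auto
  then show ?thesis
    using assms 0 by (auto simp: nabla_riemann_0 1)
next
  case (Suc m)
  then show ?thesis using assms nabla_riemann_Suc by simp
qed

lemma P_curvature_monomial:
  assumes "length is = monomial_rank ks" "s < monomial_rank ks"
  shows "curvature_monomial g ks z is = (\<Sum>c\<in>UNIV. P (is ! s) c * curvature_monomial g ks z (is[s := c]))"
  using assms
proof (induction ks arbitrary: "is" s)
  case Nil
  then show ?case by (simp add: monomial_rank_def)
next
  case (Cons k ks)
  have len: "length is = k + 4 + monomial_rank ks"
    using Cons.prems by (simp add: monomial_rank_def)
  show ?case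
  proof (cases "s < k + 4")
    case True
    then show ?thesis
      using P_nabla_riemann[of "take (k + 4) is" k s z] len
      by (simp add: take_update_swap sum_distrib_left sum_distrib_right mult_ac drop_update_cancel)
  next
    case False
    then have "is ! s = drop (k + 4) is ! (s - (k + 4))" using len by simp
    then show ?thesis
      using Cons.IH[of "drop (k + 4) is" "s - (k + 4)"] len False Cons.prems
      by (simp add: monomial_rank_def drop_update_swap sum_distrib_left mult_ac)
  qed
qed

lemma scalar_weyl_invariants_eq_0: "W \<in> scalar_weyl_invariants g \<Longrightarrow> W z = 0"
proof -
  assume "W \<in> scalar_weyl_invariants g"
  then obtain ks \<sigma> where W: "W = complete_contraction g (monomial_rank ks) \<sigma> (curvature_monomial g ks)"
    and ks: "ks \<noteq> []" "even (monomial_rank ks)" "\<sigma> permutes {..<monomial_rank ks}"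
    unfolding scalar_weyl_invariants_def by blast
  \<comment> \<open>A nonempty monomial has at least one pair of indices to contract.\<close>
  have "monomial_rank ks > 0"
    using ks(1) by (cases ks) (auto simp: monomial_rank_def)
  then show "W z = 0"
    unfolding W using ks by (intro complete_contraction_eq_0[of _ _ _ P] P_curvature_monomial P_null) auto
qed

end

subsection \<open>Scalar invariants on the zero section\<close>

lemma partial_sum:
  fixes f :: "'b \<Rightarrow> real^'n::finite \<Rightarrow> real"
  assumes "\<And>l. l \<in> I \<Longrightarrow> f l differentiable (at x)"
  shows "partial i (\<lambda>u. \<Sum>l\<in>I. f l u) x = (\<Sum>l\<in>I. partial i (f l) x)"
proof -
  have "((\<lambda>u. \<Sum>l\<in>I. f l u) has_derivative (\<lambda>v. \<Sum>l\<in>I. frechet_derivative (f l) (at x) v)) (at x)"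
    by (rule has_derivative_sum) (rule differentiable_has_derivative[OF assms])
  from partial_eqI[OF this] show ?thesis by (simp add: partial_def)
qed

lemma metric_inv_frozen_extension_differentiable:
  "(\<lambda>z. metric_inv (frozen_extension A) z a b) differentiable (at z)"
  unfolding metric_inv_frozen_extension
  by (intro differentiable_diff differentiable_mult partial_fibre_form differentiable_const)

text \<open>On the zero section the metric is the constant pairing and the Christoffel symbols
  vanish, so the curvature is read off from their first derivatives alone.\<close>

locale zero_section =
  fixes A :: "real^'n^'n::finite" and z :: "real^('n + 'n)"
  assumes fibre_0: "\<And>r. z $ Inr r = 0"
begin

abbreviation "g \<equiv> frozen_extension A"
abbreviation "L \<equiv> fibre_form_deriv A"

lemma fibre_form_0 [simp]: "fibre_form A z a = 0"
  by (simp add: fibre_form_def fibre_0 split: sum.split)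

lemma metric_inv_0: "metric_inv g z a b = (if b = dual_index a then 1 else 0)"
  by (simp add: metric_inv_frozen_extension)

lemma partial_levi_civita_0:
  "partial p (\<lambda>z. levi_civita g z i j k) z = 1/2 * ((L i j + L j i) * L p (dual_index k)
     + (L i (dual_index k) - L (dual_index k) i) * L p j + (L j (dual_index k) - L (dual_index k) j) * L p i)"
proof -
  \<comment> \<open>Each \<open>b l\<close> vanishes at \<open>z\<close>, so derivatives of the
    inverse metric do not contribute to the product rule.\<close>
  define b where "b l = (\<lambda>z. (L i j + L j i) * fibre_form A z l + (L i l - L l i) * fibre_form A z j
      + (L j l - L l j) * fibre_form A z i)" for l
  have diff_b: "b l differentiable (at z)" for l
    unfolding b_def by (intro differentiable_add differentiable_mult partial_fibre_form differentiable_const)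
  have b: "partial p (b l) z = (L i j + L j i) * L p l + (L i l - L l i) * L p j + (L j l - L l j) * L p i"
    "b l z = 0" for l
    unfolding b_def by (simp_all add: partial_add partial_mult differentiable_mult partial_fibre_form)
  have "(\<lambda>z. levi_civita g z i j k) = (\<lambda>z. 1/2 * (\<Sum>l\<in>UNIV. metric_inv g z k l * b l z))"
    by (simp add: levi_civita_frozen_extension b_def)
  then have "partial p (\<lambda>z. levi_civita g z i j k) z
      = 1/2 * partial p (\<lambda>z. \<Sum>l\<in>UNIV. metric_inv g z k l * b l z) z"
    by (simp only:, subst partial_mult)
      (auto intro!: differentiable_sum differentiable_mult metric_inv_frozen_extension_differentiable diff_b)
  also have "partial p (\<lambda>z. \<Sum>l\<in>UNIV. metric_inv g z k l * b l z) z
      = (\<Sum>l\<in>UNIV. metric_inv g z k l * partial p (b l) z)"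
    by (subst partial_sum)
      (simp_all add: partial_mult differentiable_mult metric_inv_frozen_extension_differentiable diff_b b)
  finally show ?thesis
    unfolding metric_inv_0 sum_dual_index b .
qed

lemma curvature_op_0:
  "curvature_op g z i j k l = 1/2 *
    ((L j k + L k j) * L i (dual_index l) + (L j (dual_index l) - L (dual_index l) j) * L i k
     + (L k (dual_index l) - L (dual_index l) k) * (L i j - L j i)
     - (L i k + L k i) * L j (dual_index l) - (L i (dual_index l) - L (dual_index l) i) * L j k)"
proof -
  have "levi_civita g z i j k = 0" for i j k
    by (simp add: levi_civita_frozen_extension)
  then show ?thesis
    unfolding curvature_op_def partial_levi_civita_0 by (simp add: algebra_simps)
qed

lemma riemann_0:
  "riemann g z i j k l = 1/2 *
    ((L j k + L k j) * L i l + (L j l - L l j) * L i k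
     + (L k l - L l k) * (L i j - L j i)
     - (L i k + L k i) * L j l - (L i l - L l i) * L j k)"
proof -
  have "riemann g z i j k l = curvature_op g z i j k (dual_index l)"
    by (simp add: riemann_def frozen_extension_nth)
  then show ?thesis
    by (simp add: curvature_op_0)
qed

lemma scalar_curvature_0: "scalar_curvature g z = (\<Sum>i\<in>UNIV. ricci g z i (dual_index i))"
  unfolding scalar_curvature_def metric_inv_0 by simp

lemma ricci_norm_sq_0:
  "ricci_norm_sq g z = (\<Sum>i\<in>UNIV. \<Sum>j\<in>UNIV. ricci g z i j * ricci g z (dual_index i) (dual_index j))"
  unfolding ricci_norm_sq_def metric_inv_0 mult.assoc sum_distrib_left[symmetric] sum_dual_index ..

lemma riemann_norm_sq_0:
  "riemann_norm_sq g z = (\<Sum>i\<in>UNIV. \<Sum>j\<in>UNIV. \<Sum>k\<in>UNIV. \<Sum>l\<in>UNIV. riemann g z i j k l *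
     riemann g z (dual_index i) (dual_index j) (dual_index k) (dual_index l))"
  unfolding riemann_norm_sq_def metric_inv_0 mult.assoc sum_distrib_left[symmetric] sum_dual_index ..

end

locale zero_section_2 = zero_section A z for A :: "real^2^2" and z
begin

abbreviation "t \<equiv> A $ 1 $ 1 + A $ 2 $ 2"
abbreviation "d \<equiv> A $ 1 $ 1 * A $ 2 $ 2 - A $ 1 $ 2 * A $ 2 $ 1"

lemma ricci_0:
  "ricci g z (Inl j) (Inl k) = 0" "ricci g z (Inr j) (Inr k) = 0"
  "ricci g z (Inl j) (Inr k) = t * A $ k $ j - (if j = k then d / 2 else 0)"
  "ricci g z (Inr k) (Inl j) = t * A $ k $ j - (if j = k then d / 2 else 0)"
  using exhaust_2[of j] exhaust_2[of k]
  by (auto simp: ricci_def curvature_op_0 sum_UNIV_Plus sum_2 field_simps)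

lemma scalar_curvature_eq: "scalar_curvature g z = 2 * t\<^sup>2 - 2 * d"
  by (simp add: scalar_curvature_0 sum_UNIV_Plus sum_2 ricci_0 algebra_simps power2_eq_square)

lemma ricci_norm_sq_eq: "ricci_norm_sq g z = 2 * t ^ 4 - 6 * t\<^sup>2 * d + d\<^sup>2"
  by (simp add: ricci_norm_sq_0 sum_UNIV_Plus sum_2 ricci_0) algebra

definition quad_coeff :: "2 \<Rightarrow> 2 \<Rightarrow> 2 \<Rightarrow> 2 \<Rightarrow> real" where
  "quad_coeff r s i k = A $ r $ i * A $ s $ k + A $ s $ i * A $ r $ k"

text \<open>Leaves in the norm only terms whose two antisymmetric index pairs each consist of one
  base and one fibre index.\<close>

lemma riemann_types:
  "riemann g z (Inl i) (Inr r) (Inl k) (Inr s) = quad_coeff r s i k / 2"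
  "riemann g z (Inl i) (Inr r) (Inr s) (Inl k) = - quad_coeff r s i k / 2"
  "riemann g z (Inr r) (Inl i) (Inl k) (Inr s) = - quad_coeff r s i k / 2"
  "riemann g z (Inr r) (Inl i) (Inr s) (Inl k) = quad_coeff r s i k / 2"
  "riemann g z (Inl i) (Inl j) a b = 0"
  "riemann g z (Inr i) (Inr j) a b = 0"
  "riemann g z a b (Inl i) (Inl j) = 0"
  "riemann g z a b (Inr i) (Inr j) = 0"
  by (cases a; cases b; simp add: riemann_0 quad_coeff_def field_simps)+

lemma riemann_norm_sq_eq: "riemann_norm_sq g z = 4 * (t\<^sup>2 - d) * (t\<^sup>2 - 3 * d)"
proof -
  have comm: "quad_coeff r s k i = quad_coeff r s i k" "quad_coeff s r i k = quad_coeff r s i k" for r s i k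
    by (simp_all add: quad_coeff_def)
  have "riemann_norm_sq g z = (quad_coeff 1 1 1 1)\<^sup>2 + (quad_coeff 2 2 2 2)\<^sup>2 + 2 * quad_coeff 1 1 2 2 * quad_coeff 2 2 1 1
    + 4 * quad_coeff 1 1 1 2 * quad_coeff 1 2 1 1 + 4 * quad_coeff 2 2 1 2 * quad_coeff 1 2 2 2 + 4 * (quad_coeff 1 2 1 2)\<^sup>2"
    unfolding riemann_norm_sq_0 sum_UNIV_Plus dual_index_simps riemann_types
    by (simp add: sum_2 comm[of _ _ 2 1] comm(2)[of 2 1] power2_eq_square)
  also have "\<dots> = 4 * (t\<^sup>2 - d) * (t\<^sup>2 - 3 * d)"
    unfolding quad_coeff_def by algebra
  finally show ?thesis .
qed

end

section \<open>Nilpotent matrices of size two\<close>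

text \<open>An instance of Cayley-Hamilton, A^2 = t A - d I with trace t and determinant d, verified
  here on entries.\<close>

lemma matrix_square_2:
  fixes A :: "real^2^2"
  shows "A ** A = 0 \<longleftrightarrow> A $ 1 $ 1 + A $ 2 $ 2 = 0 \<and> A $ 1 $ 1 * A $ 2 $ 2 - A $ 1 $ 2 * A $ 2 $ 1 = 0"
proof -
  have "A ** A = 0 \<longleftrightarrow> A $ 1 $ 1 * A $ 1 $ 1 + A $ 1 $ 2 * A $ 2 $ 1 = 0 \<and> A $ 1 $ 2 * (A $ 1 $ 1 + A $ 2 $ 2) = 0
      \<and> A $ 2 $ 1 * (A $ 1 $ 1 + A $ 2 $ 2) = 0 \<and> A $ 2 $ 2 * A $ 2 $ 2 + A $ 1 $ 2 * A $ 2 $ 1 = 0"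
    by (auto simp: vec_eq_iff matrix_matrix_mult_def sum_2 forall_2 algebra_simps)
  also have "\<dots> \<longleftrightarrow> A $ 1 $ 1 + A $ 2 $ 2 = 0 \<and> A $ 1 $ 1 * A $ 2 $ 2 - A $ 1 $ 2 * A $ 2 $ 1 = 0"
  proof (intro iffI; elim conjE)
    assume *: "A $ 1 $ 1 * A $ 1 $ 1 + A $ 1 $ 2 * A $ 2 $ 1 = 0" "A $ 1 $ 2 * (A $ 1 $ 1 + A $ 2 $ 2) = 0"
      "A $ 2 $ 2 * A $ 2 $ 2 + A $ 1 $ 2 * A $ 2 $ 1 = 0"
    have t: "A $ 1 $ 1 + A $ 2 $ 2 = 0"
      \<comment> \<open>If this entry is 0, both diagonal entries have square 0; otherwise it can be
        cancelled from the second equation.\<close>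
      using * by (cases "A $ 1 $ 2 = 0") auto
    then have "A $ 2 $ 2 = - A $ 1 $ 1" by simp
    with t * show "A $ 1 $ 1 + A $ 2 $ 2 = 0 \<and> A $ 1 $ 1 * A $ 2 $ 2 - A $ 1 $ 2 * A $ 2 $ 1 = 0"
      by simp
  next
    assume t: "A $ 1 $ 1 + A $ 2 $ 2 = 0" and *: "A $ 1 $ 1 * A $ 2 $ 2 - A $ 1 $ 2 * A $ 2 $ 1 = 0"
    show "A $ 1 $ 1 * A $ 1 $ 1 + A $ 1 $ 2 * A $ 2 $ 1 = 0 \<and> A $ 1 $ 2 * (A $ 1 $ 1 + A $ 2 $ 2) = 0
      \<and> A $ 2 $ 1 * (A $ 1 $ 1 + A $ 2 $ 2) = 0 \<and> A $ 2 $ 2 * A $ 2 $ 2 + A $ 1 $ 2 * A $ 2 $ 1 = 0"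
      by (intro conjI) (use t * in algebra)+
  qed
  finally show ?thesis .
qed

lemma nilpotent_2_rank_1:
  fixes A :: "real^2^2"
  assumes "A ** A = 0"
  obtains u v :: "real^2" where "nilpotent_frozen A u v"
proof -
  define p q r where "p = A $ 1 $ 1" and "q = A $ 1 $ 2" and "r = A $ 2 $ 1"
  have td: "A $ 1 $ 1 + A $ 2 $ 2 = 0" "A $ 1 $ 1 * A $ 2 $ 2 - A $ 1 $ 2 * A $ 2 $ 1 = 0"
    using assms by (simp_all add: matrix_square_2)
  then have A: "A $ 1 $ 1 = p" "A $ 1 $ 2 = q" "A $ 2 $ 1 = r" "A $ 2 $ 2 = - p"
    by (auto simp: p_def q_def r_def)
  have pqr: "p * p = - q * r"
    using td unfolding A by simp
  consider "q \<noteq> 0" | "r \<noteq> 0" | "p = 0" "q = 0" "r = 0"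
    using pqr by force
  then show thesis
  proof cases
    case 1
    \<comment> \<open>The left vector is the second column of the matrix and the right one lists the
      multiples giving the columns. The next case uses the first column in the same way.\<close>
    have "A $ i $ j = vector [q, - p] $ i * vector [p / q, 1] $ j" for i j
      using pqr 1 exhaust_2[of i] exhaust_2[of j] by (auto simp: A field_simps)
    with 1 have "nilpotent_frozen A (vector [q, - p]) (vector [p / q, 1])"
      by unfold_locales (simp_all add: sum_2)
    then show thesis by (rule that)
  next
    case 2
    have "A $ i $ j = vector [p, r] $ i * vector [1, - p / r] $ j" for i j
      using pqr 2 exhaust_2[of i] exhaust_2[of j] by (auto simp: A field_simps)
    with 2 have "nilpotent_frozen A (vector [p, r]) (vector [1, - p / r])"
      by unfold_locales (simp_all add: sum_2)
    then show thesis by (rule that)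
  next
    case 3
    have "A $ i $ j = 0" for i j
      using 3 exhaust_2[of i] exhaust_2[of j] by (auto simp: A)
    then have "nilpotent_frozen A 0 0"
      by unfold_locales simp_all
    then show thesis by (rule that)
  qed
qed

subsection \<open>Curvature norms as scalar Weyl invariants\<close>

lemma sum_lists_Suc:
  fixes F :: "'a::finite list \<Rightarrow> real"
  shows "(\<Sum>is | length is = Suc n. F is) = (\<Sum>a\<in>UNIV. \<Sum>is | length is = n. F (a # is))"
proof -
  have "(\<Sum>is | length is = Suc n. F is) = (\<Sum>(a, is)\<in>UNIV \<times> {is. length is = n}. F (a # is))"
    by (rule sum.reindex_bij_witness[where i = "\<lambda>(a, is). a # is" and j = "\<lambda>is. (hd is, tl is)"])
      (auto simp: length_Suc_conv)
  then show ?thesis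
    by (simp add: sum.cartesian_product)
qed

text \<open>Rank 8 is that of a product of two undifferentiated curvature tensors, from which both
  norms are formed.\<close>

lemma complete_contraction_8:
  "complete_contraction g 8 \<sigma> A x =
    (\<Sum>a\<in>UNIV. \<Sum>b\<in>UNIV. \<Sum>c\<in>UNIV. \<Sum>d\<in>UNIV. \<Sum>e\<in>UNIV. \<Sum>f\<in>UNIV. \<Sum>h\<in>UNIV. \<Sum>k\<in>UNIV.
      let is = [a, b, c, d, e, f, h, k]; m = (\<lambda>i j. metric_inv g x (is ! \<sigma> i) (is ! \<sigma> j)) in
      m 0 1 * m 2 3 * m 4 5 * m 6 7 * A x is)"
proof -
  have sum8: "(\<Sum>is | length is = 8. F is) = (\<Sum>a\<in>UNIV. \<Sum>b\<in>UNIV. \<Sum>c\<in>UNIV. \<Sum>d\<in>UNIV.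
      \<Sum>e\<in>UNIV. \<Sum>f\<in>UNIV. \<Sum>h\<in>UNIV. \<Sum>k\<in>UNIV. F [a, b, c, d, e, f, h, k])"
    for F :: "'a list \<Rightarrow> real"
    by (simp add: eval_nat_numeral sum_lists_Suc)
  have prod4: "(\<Prod>j<8 div 2. f j) = f 0 * f 1 * f 2 * f 3" for f :: "nat \<Rightarrow> real"
  proof -
    have "{..<8 div 2} = {0, 1, 2, 3 :: nat}" by auto
    then show ?thesis by (simp add: mult_ac)
  qed
  show ?thesis
    unfolding complete_contraction_def sum8 prod4 by (simp add: Let_def)
qed

lemma list_permutes:
  assumes "distinct xs" "set xs = {..<length xs}"
  shows "(\<lambda>j. if j < length xs then xs ! j else j) permutes {..<length xs}"
proof (rule bij_imp_permutes)
  show "bij_betw (\<lambda>j. if j < length xs then xs ! j else j) {..<length xs} {..<length xs}"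
    using bij_betw_nth[OF assms(1) refl assms(2)[symmetric]] by (rule bij_betw_cong[THEN iffD2, rotated]) simp
qed simp

lemma curvature_monomial_contraction:
  fixes xs :: "nat list"
  assumes "length xs = 8" "distinct xs" "set xs = {..<8}"
  defines "\<sigma> \<equiv> \<lambda>j. if j < length xs then xs ! j else j"
  shows "complete_contraction g 8 \<sigma> (curvature_monomial g [0, 0]) \<in> scalar_weyl_invariants g"
  unfolding scalar_weyl_invariants_def mem_Collect_eq
  by (rule exI[where x = "[0, 0]"], rule exI[where x = \<sigma>])
    (use list_permutes[of xs] assms in \<open>simp add: monomial_rank_def\<close>)

lemma riemann_norm_sq_weyl: "riemann_norm_sq g \<in> scalar_weyl_invariants g"
proof -
  \<comment> \<open>Consecutive entries are paired: each slot of the first factor meets the same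
    slot of the second.\<close>
  let ?xs = "[0, 4, 1, 5, 2, 6, 3, 7] :: nat list"
  have "riemann_norm_sq g x =
      complete_contraction g 8 (\<lambda>j. if j < length ?xs then ?xs ! j else j) (curvature_monomial g [0, 0]) x" for x
    by (simp add: riemann_norm_sq_def complete_contraction_8
        nabla_riemann_def riemann_tensor_def sum_distrib_left mult_ac)
  then have "riemann_norm_sq g =
      complete_contraction g 8 (\<lambda>j. if j < length ?xs then ?xs ! j else j) (curvature_monomial g [0, 0])"
    by blast
  moreover have "set ?xs = {..<8}"
    by (intro set_eqI) (simp, presburger)
  ultimately show ?thesis
    using curvature_monomial_contraction[of ?xs g] by simp
qed

text \<open>The inverse metric undoes the lowering of the last index, so tracing slots
  \<open>i\<close> and \<open>l\<close> gives Ricci. \<open>Q\<close> stands for whatever is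
  contracted with the other two slots.\<close>

lemma ricci_trace:
  assumes inv: "\<And>a d. (\<Sum>b\<in>UNIV. metric_inv g x a b * g x $ b $ d) = (if a = d then 1 else 0)"
  shows "(\<Sum>i\<in>UNIV. \<Sum>j\<in>UNIV. \<Sum>k\<in>UNIV. \<Sum>l\<in>UNIV. metric_inv g x i l * riemann g x i j k l * Q j k)
    = (\<Sum>j\<in>UNIV. \<Sum>k\<in>UNIV. ricci g x j k * Q j k)"
proof -
  have "(\<Sum>l\<in>UNIV. metric_inv g x i l * riemann g x i j k l) = curvature_op g x i j k i" for i j k
  proof -
    have "(\<Sum>l\<in>UNIV. metric_inv g x i l * riemann g x i j k l)
        = (\<Sum>l\<in>UNIV. \<Sum>m\<in>UNIV. metric_inv g x i l * g x $ l $ m * curvature_op g x i j k m)"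
      by (simp add: riemann_def sum_distrib_left mult.assoc)
    also have "\<dots> = (\<Sum>m\<in>UNIV. (\<Sum>l\<in>UNIV. metric_inv g x i l * g x $ l $ m) * curvature_op g x i j k m)"
      unfolding sum_distrib_right by (rule sum.swap)
    finally show ?thesis
      by (simp add: inv mult_delta_left)
  qed
  then have "(\<Sum>i\<in>UNIV. \<Sum>j\<in>UNIV. \<Sum>k\<in>UNIV. \<Sum>l\<in>UNIV. metric_inv g x i l * riemann g x i j k l * Q j k)
    = (\<Sum>i\<in>UNIV. \<Sum>j\<in>UNIV. \<Sum>k\<in>UNIV. curvature_op g x i j k i * Q j k)"
    by (simp add: sum_distrib_right[symmetric])
  also have "\<dots> = (\<Sum>j\<in>UNIV. \<Sum>i\<in>UNIV. \<Sum>k\<in>UNIV. curvature_op g x i j k i * Q j k)"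
    by (rule sum.swap)
  also have "\<dots> = (\<Sum>j\<in>UNIV. \<Sum>k\<in>UNIV. \<Sum>i\<in>UNIV. curvature_op g x i j k i * Q j k)"
    by (intro sum.cong refl sum.swap)
  finally show ?thesis
    by (simp add: ricci_def sum_distrib_right)
qed

lemma ricci_norm_sq_weyl:
  assumes inv: "\<And>x a d. (\<Sum>b\<in>UNIV. metric_inv g x a b * g x $ b $ d) = (if a = d then 1 else 0)"
  shows "ricci_norm_sq g \<in> scalar_weyl_invariants g"
proof -
  \<comment> \<open>The pairs (0,3) and (4,7) trace each factor to its Ricci tensor; (1,5) and (2,6)
    contract the two Ricci tensors.\<close>
  let ?xs = "[0, 3, 1, 5, 2, 6, 4, 7] :: nat list"
  have "ricci_norm_sq g x =
      complete_contraction g 8 (\<lambda>j. if j < length ?xs then ?xs ! j else j) (curvature_monomial g [0, 0]) x" for x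
  proof -
    let ?m = "metric_inv g x" and ?R = "riemann g x"
    have "complete_contraction g 8 (\<lambda>j. if j < length ?xs then ?xs ! j else j) (curvature_monomial g [0, 0]) x
      = (\<Sum>i\<in>UNIV. \<Sum>j\<in>UNIV. \<Sum>k\<in>UNIV. \<Sum>l\<in>UNIV. ?m i l * ?R i j k l *
          (\<Sum>a\<in>UNIV. \<Sum>b\<in>UNIV. \<Sum>c\<in>UNIV. \<Sum>d\<in>UNIV. ?m a d * ?R a b c d * (?m j b * ?m k c)))"
      by (simp add: complete_contraction_8
        nabla_riemann_def riemann_tensor_def sum_distrib_left mult_ac)
    also have "\<dots> = ricci_norm_sq g x"
      unfolding ricci_trace[OF inv] ricci_norm_sq_def by (simp add: mult_ac)
    finally show ?thesis ..
  qed
  then have "ricci_norm_sq g =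
      complete_contraction g 8 (\<lambda>j. if j < length ?xs then ?xs ! j else j) (curvature_monomial g [0, 0])"
    by blast
  moreover have "set ?xs = {..<8}"
    by (intro set_eqI) (simp, presburger)
  ultimately show ?thesis
    using curvature_monomial_contraction[of ?xs g] by simp
qed

lemma chart_range_cotangent_bundle:
  assumes "z \<in> chart_range (cotangent_bundle M) c"
  shows "base_coords z \<in> chart_range M c"
proof -
  from assms obtain p \<omega> where "p \<in> chart_dom M c" "z = chart_map (cotangent_bundle M) c (p, \<omega>)"
    by (auto simp: chart_range_def cotangent_bundle_def)
  then have "p \<in> chart_dom M c" "base_coords z = chart_map M c p"
    by (auto simp: cotangent_bundle_def vec_eq_iff)
  then show ?thesis by (auto simp: chart_range_def)
qed

text \<open>The zero family obeys the transformation law of covectors, so every base point has a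
  test point on the zero section.\<close>

lemma zero_section_chart_range:
  assumes "x \<in> chart_range M c"
  obtains z where "z \<in> chart_range (cotangent_bundle M) c" "base_coords z = x" "\<And>r. z $ Inr r = 0"
proof -
  from assms obtain p where p: "p \<in> chart_dom M c" "x = chart_map M c p"
    by (auto simp: chart_range_def)
  let ?z = "chart_map (cotangent_bundle M) c (p, \<lambda>_. 0)"
  have "(\<lambda>_. 0) \<in> cotangent_space M p"
    by (simp add: cotangent_space_def)
  then have "?z \<in> chart_range (cotangent_bundle M) c"
    using p by (auto simp: chart_range_def cotangent_bundle_def)
  then show thesis
    by (rule that) (auto simp: cotangent_bundle_def vec_eq_iff p)
qed

lemma metric_leading_part_modified_riemannian_extension:
  assumes "affine_surface M \<Gamma>" "tensor_field_1_1 M T" "symmetric_2_tensor_field M \<Phi>" "c \<in> charts M"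
    "x \<in> chart_range M c"
  shows "metric_leading_part (chart_range M c) x (modified_riemannian_extension T \<Gamma> \<Phi> c)
    (frozen_extension (T c x))"
proof (rule metric_leading_part_frozen_extension)
  show T: "smooth_on (chart_range M c) (\<lambda>x. T c x $ r $ i)" for r i
    using assms by (simp add: tensor_field_1_1_def)
  show "open (chart_range M c)"
    by (rule smooth_onD(1)[OF T])
  show "smooth_on (chart_range M c) (\<lambda>x. \<Gamma> c x i j k)" for i j k
    using assms by (simp add: affine_surface_def connection_def)
  show "smooth_on (chart_range M c) (\<lambda>x. \<Phi> c x $ i $ j)" for i j
    using assms by (simp add: symmetric_2_tensor_field_def)
qed

text \<open>The second assumption forces d = t^2 or t^2 = 3 d. On these curves the first polynomial
  becomes -3 t^4 and d^2 respectively. The disjunction serves the Riemann norm and the scalar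
  curvature at once.\<close>

lemma trace_det_eq_0:
  fixes t d :: real
  assumes "2 * t ^ 4 - 6 * t\<^sup>2 * d + d\<^sup>2 = 0"
    and "4 * (t\<^sup>2 - d) * (t\<^sup>2 - 3 * d) = 0 \<or> 2 * t\<^sup>2 - 2 * d = 0"
  shows "t = 0 \<and> d = 0"
proof -
  consider "d = t\<^sup>2" | "t\<^sup>2 = 3 * d"
    using assms(2) by fastforce
  then show ?thesis
  proof cases
    case 1
    then have "t ^ 4 = 0" using assms(1) by algebra
    with 1 show ?thesis by simp
  next
    case 2
    then have "d\<^sup>2 = 0" using assms(1) by algebra
    with 2 show ?thesis by simp
  qed
qed

lemma (in metric_leading_part) eq_frozen:
  assumes "lp 0 F F0" "x0 \<in> V" "base_coords z = x0"
  shows "F z = F0 z"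
  using leading_part_unique[OF assms(1), of z] assms(2,3) by simp

lemma (in metric_leading_part) scalar_weyl_invariants:
  assumes "W \<in> scalar_weyl_invariants g"
  shows "\<exists>W0\<in>scalar_weyl_invariants g0. lp 0 W W0"
proof -
  from assms obtain ks \<sigma> where "W = complete_contraction g (monomial_rank ks) \<sigma> (curvature_monomial g ks)"
    and ks: "ks \<noteq> []" "even (monomial_rank ks)" "\<sigma> permutes {..<monomial_rank ks}"
    unfolding scalar_weyl_invariants_def by blast
  then have "lp 0 W (complete_contraction g0 (monomial_rank ks) \<sigma> (curvature_monomial g0 ks))"
    using complete_contraction[OF curvature_monomial] by simp
  then show ?thesis
    using ks unfolding scalar_weyl_invariants_def by blast
qed

theorem theorem1p5:
  fixes M :: "('a, 'c, 2) manifold"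
    and \<Gamma> :: "('c, 2) christoffel_field"
    and T \<Phi> :: "('c, 2) matrix_field"
    and N :: "('a \<times> ('c \<Rightarrow> real^2), 'c, 2 + 2) manifold"
    and g :: "('c, 2 + 2) matrix_field"
  assumes "affine_surface M \<Gamma>"
    and "tensor_field_1_1 M T" and "\<not> zero_1_1 M T"
    and "symmetric_2_tensor_field M \<Phi>"
    and "N = cotangent_bundle M"
    and "g = modified_riemannian_extension T \<Gamma> \<Phi>"
  shows "(VSI N g \<longleftrightarrow>
            vanishes_identically N (\<lambda>c. riemann_norm_sq (g c)) \<and>
            vanishes_identically N (\<lambda>c. ricci_norm_sq (g c)))
       \<and> (vanishes_identically N (\<lambda>c. riemann_norm_sq (g c)) \<and>
          vanishes_identically N (\<lambda>c. ricci_norm_sq (g c)) \<longleftrightarrow>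
            vanishes_identically N (\<lambda>c. ricci_norm_sq (g c)) \<and>
            vanishes_identically N (\<lambda>c. scalar_curvature (g c)))
       \<and> (vanishes_identically N (\<lambda>c. ricci_norm_sq (g c)) \<and>
          vanishes_identically N (\<lambda>c. scalar_curvature (g c)) \<longleftrightarrow>
            nilpotent_1_1 M T)"
proof -
  let ?R = "vanishes_identically N (\<lambda>c. riemann_norm_sq (g c))"
    and ?\<rho> = "vanishes_identically N (\<lambda>c. ricci_norm_sq (g c))"
    and ?\<tau> = "vanishes_identically N (\<lambda>c. scalar_curvature (g c))"
  have charts: "charts N = charts M"
    by (simp add: assms cotangent_bundle_def)
  have frozen: "metric_leading_part (chart_range M c) x (g c) (frozen_extension (T c x))"
    if "c \<in> charts M" "x \<in> chart_range M c" for c x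
    unfolding assms(6)
    by (rule metric_leading_part_modified_riemannian_extension[OF assms(1,2,4) that])
  \<comment> \<open>Both norms are themselves scalar Weyl invariants.\<close>
  have "?R \<and> ?\<rho>" if "VSI N g"
  proof -
    have "riemann_norm_sq (g c) \<in> scalar_weyl_invariants (g c)"
      "ricci_norm_sq (g c) \<in> scalar_weyl_invariants (g c)" for c
      unfolding assms(6)
      by (rule riemann_norm_sq_weyl, rule ricci_norm_sq_weyl[OF metric_inv_modified_riemannian_extension(5)])
    then show ?thesis
      using that by (simp add: VSI_def vanishes_identically_def)
  qed
  \<comment> \<open>Either pair of vanishing scalars, evaluated on the zero section, kills the trace
    and determinant of \<open>T\<close> at each base point.\<close>
  moreover have "nilpotent_1_1 M T" if "(?R \<or> ?\<tau>) \<and> ?\<rho>"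
    unfolding nilpotent_1_1_def
  proof (intro ballI)
    fix c x assume c: "c \<in> charts M" and x: "x \<in> chart_range M c"
    obtain z where z: "z \<in> chart_range N c" "base_coords z = x" "\<And>r. z $ Inr r = 0"
      using zero_section_chart_range[OF x] assms(5) by blast
    interpret metric_leading_part "chart_range M c" x "g c" "frozen_extension (T c x)"
      using c x by (rule frozen)
    interpret zero: zero_section_2 "T c x" z
      by unfold_locales (rule z)
    have "2 * zero.t ^ 4 - 6 * zero.t\<^sup>2 * zero.d + zero.d\<^sup>2 = 0"
      using that c z eq_frozen[OF ricci_norm_sq x z(2)]
      by (auto simp: vanishes_identically_def charts zero.ricci_norm_sq_eq)
    moreover have "4 * (zero.t\<^sup>2 - zero.d) * (zero.t\<^sup>2 - 3 * zero.d) = 0 \<or> 2 * zero.t\<^sup>2 - 2 * zero.d = 0"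
      using that c z eq_frozen[OF riemann_norm_sq x z(2)] eq_frozen[OF scalar_curvature x z(2)]
      by (auto simp: vanishes_identically_def charts zero.riemann_norm_sq_eq zero.scalar_curvature_eq)
    ultimately show "T c x ** T c x = 0"
      unfolding matrix_square_2 by (rule trace_det_eq_0)
  qed
  moreover have "VSI N g \<and> ?\<rho> \<and> ?\<tau>" if "nilpotent_1_1 M T"
  proof -
    have "(\<forall>W\<in>scalar_weyl_invariants (g c). W z = 0) \<and> ricci_norm_sq (g c) z = 0 \<and> scalar_curvature (g c) z = 0"
      if c: "c \<in> charts M" and z: "z \<in> chart_range N c" for c z
    proof -
      have x: "base_coords z \<in> chart_range M c"
        using z unfolding assms(5) by (rule chart_range_cotangent_bundle)
      \<comment> \<open>The metric is frozen at the base point of \<open>z\<close> itself, so the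
        comparison holds at an arbitrary covector and not only on the zero section.\<close>
      interpret metric_leading_part "chart_range M c" "base_coords z" "g c" "frozen_extension (T c (base_coords z))"
        using c x by (rule frozen)
      have "T c (base_coords z) ** T c (base_coords z) = 0"
        using \<open>nilpotent_1_1 M T\<close> c x by (simp add: nilpotent_1_1_def)
      then obtain u v where "nilpotent_frozen (T c (base_coords z)) u v"
        by (rule nilpotent_2_rank_1)
      then interpret nil: nilpotent_frozen "T c (base_coords z)" u v .
      have "W z = 0" if W: "W \<in> scalar_weyl_invariants (g c)" for W
      proof -
        obtain W0 where "W0 \<in> scalar_weyl_invariants nil.g" "lp 0 W W0"
          using scalar_weyl_invariants[OF W] by blast
        then show ?thesis
          using eq_frozen[of W W0 z] x nil.scalar_weyl_invariants_eq_0[of W0 z] by simp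
      qed
      moreover have "ricci_norm_sq (g c) z = 0"
        unfolding eq_frozen[OF ricci_norm_sq x refl] by (simp add: ricci_norm_sq_def nil.ricci_eq)
      moreover have "scalar_curvature (g c) z = 0"
        unfolding eq_frozen[OF scalar_curvature x refl] by (simp add: scalar_curvature_def nil.ricci_eq)
      ultimately show ?thesis by blast
    qed
    then show ?thesis
      by (auto simp: VSI_def vanishes_identically_def charts)
  qed
  ultimately show ?thesis by blast
qed

end
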